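(* Let $k\ge 1$ and $0\le a\le k$ be integers, and let $M$ be any positive integer not congruent to $0$ or $\pm (k+1-a)$ modulo $2k+3$. Then $$ \begin{aligned} &\frac{1-q^M}{1-xq^M}\,\frac{(q^{k+1-a},q^{k+2+a},q^{2k+3};q^{2k+3})_\infty}{(q;q)_\infty} =1+A+ \sum_{n_1=2}^\infty \frac{q^{n_1^2+B}}{(q^2;q)_{n_1-1}}\,\frac{[M]_q}{1-xq^M}\\ &\qquad+\sum_{r=2}^k\ \sum_{n_1\ge n_{2} \ge \cdots \ge n_r\ge 1} \frac{q^{n_1^2+n_2^2+\cdots +n_r^2+n_{k+1-a}+\cdots +n_r}} {(q)_{n_1-n_2}\cdots (q)_{n_{r-1}-n_r}(q^2;q)_{n_r-1}}\,\frac{[M]_q}{1-xq^M}, \end{aligned} $$ where (1) for $0\le a<k$: $B=0$ and $A=\dfrac{q\left([M-1]_q+xq^{M-1}\right)}{1-xq^M}$; (2) for $a=k$: $B=n_1$ and $A=\dfrac{q^2\left([M-2]_q+xq^{M-2}+q^{M-1}\right)}{1-xq^M}$.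
   Context: Here $x$ is an indeterminate and the identity is one of formal power series in $q$ with coefficients polynomial in $x$. Notation: $(A;p)_m=\prod_{i=0}^{m-1}(1-Ap^i)$, $(A;p)_\infty=\prod_{i\ge0}(1-Ap^i)$, $(A_1,A_2,A_3;p)_\infty=(A_1;p)_\infty(A_2;p)_\infty(A_3;p)_\infty$, $(q)_m=(q;q)_m$, and $[M]_q=\frac{1-q^M}{1-q}$ (so $[0]_q=0$). In the exponent, the linear sum $n_{k+1-a}+\cdots+n_r$ means $\sum_{i=k+1-a}^{r}n_i$, which is empty (zero) if $r<k+1-a$. For $k=1$ the sum over $r$ is empty. *)

theory Defs
  imports
    "HOL-Analysis.Analysis"
    "HOL-Computational_Algebra.Computational_Algebra"
    "HOL-Number_Theory.Cong"
begin

unbundle no vec_syntax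

text \<open>
  The ambient ring is \<open>\<int>[x][[q]]\<close>, the type \<^typ>\<open>int poly fps\<close>.  Infinite products and sums are the
  library's \<^const>\<open>prodinf\<close> and \<^const>\<open>infsum\<close> for its topology on formal power series (coefficientwise
  stabilisation).
\<close>

abbreviation qq :: "int poly fps" where
  "qq \<equiv> fps_X"

abbreviation xx :: "int poly fps" where
  "xx \<equiv> fps_const [:0, 1:]"

text \<open>
  \<^typ>\<open>int poly\<close> has no multiplicative inverse operation, so the library division on power series is
  not available here.  The quotient below is the genuine one whenever the denominator has
  constant term 1 (lemma \<open>fps_quot_mult\<close>), which holds for every denominator used.
\<close>
definition fps_quot :: "int poly fps \<Rightarrow> int poly fps \<Rightarrow> int poly fps" (infixl \<open>'/\<^sub>q\<close> 70) where
  "f /\<^sub>q g = f * fps_right_inverse g 1"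

lemma fps_quot_mult:
  assumes "g $ 0 = 1"
  shows "(f /\<^sub>q g) * g = f"
proof -
  have "g * fps_right_inverse g 1 = 1"
    by (rule fps_right_inverse) (simp add: assms)
  then show ?thesis
    by (simp add: fps_quot_def mult.assoc mult.commute[of _ g])
qed

definition qpoch :: "int poly fps \<Rightarrow> int poly fps \<Rightarrow> nat \<Rightarrow> int poly fps" where
  "qpoch A p m = (\<Prod>i<m. 1 - A * p ^ i)"

definition qpoch_inf :: "int poly fps \<Rightarrow> int poly fps \<Rightarrow> int poly fps" where
  "qpoch_inf A p = (\<Prod>i. 1 - A * p ^ i)"

definition qpoch_inf3 ::
  "int poly fps \<Rightarrow> int poly fps \<Rightarrow> int poly fps \<Rightarrow> int poly fps \<Rightarrow> int poly fps" where
  "qpoch_inf3 A\<^sub>1 A\<^sub>2 A\<^sub>3 p = qpoch_inf A\<^sub>1 p * qpoch_inf A\<^sub>2 p * qpoch_inf A\<^sub>3 p"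

definition qint :: "nat \<Rightarrow> int poly fps" where
  "qint M = (1 - qq ^ M) /\<^sub>q (1 - qq)"

text \<open>The tuples \<open>n\<^sub>1 \<ge> \<dots> \<ge> n\<^sub>r \<ge> 1\<close>, as functions on \<open>{1..r}\<close>.\<close>
definition decr_tuples :: "nat \<Rightarrow> (nat \<Rightarrow> nat) set" where
  "decr_tuples r = {n \<in> {1..r} \<rightarrow>\<^sub>E {1..}. \<forall>i\<in>{1..<r}. n (i + 1) \<le> n i}"

text \<open>In the exponent, \<open>{k+1-a..r}\<close> is empty for \<open>r < k+1-a\<close>; truncation is harmless as \<open>a \<le> k\<close>.\<close>
definition multisum_term :: "nat \<Rightarrow> nat \<Rightarrow> nat \<Rightarrow> (nat \<Rightarrow> nat) \<Rightarrow> int poly fps" where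
  "multisum_term k a r n =
     qq ^ ((\<Sum>i=1..r. n i ^ 2) + (\<Sum>i=k+1-a..r. n i))
       /\<^sub>q ((\<Prod>i=1..<r. qpoch qq qq (n i - n (i + 1))) * qpoch (qq ^ 2) qq (n r - 1))"

text \<open>
  The subtractions \<open>M - 1\<close> and \<open>M - 2\<close> are used only for \<open>M \<ge> 1\<close> and, when \<open>a = k\<close>, for \<open>M \<ge> 2\<close>
  (\<open>M = 1\<close> is then excluded by \<open>M \<noteq> k + 1 - a\<close> modulo \<open>2 k + 3\<close>).
\<close>
definition A_term :: "nat \<Rightarrow> nat \<Rightarrow> nat \<Rightarrow> int poly fps" where
  "A_term k a M =
     (if a < k
      then (qq * (qint (M - 1) + xx * qq ^ (M - 1))) /\<^sub>q (1 - xx * qq ^ M)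
      else (qq ^ 2 * (qint (M - 2) + xx * qq ^ (M - 2) + qq ^ (M - 1))) /\<^sub>q (1 - xx * qq ^ M))"

definition B_exp :: "nat \<Rightarrow> nat \<Rightarrow> nat \<Rightarrow> nat" where
  "B_exp k a n = (if a < k then 0 else n)"


text \<open>
  Well-definedness: denominators have constant term 1, the products converge and the sums are
  summable, so no default value of \<^const>\<open>prodinf\<close> or \<^const>\<open>infsum\<close> enters.
\<close>

lemma fps_prod_nth_0: "(\<Prod>i\<in>I. f i :: int poly fps) $ 0 = (\<Prod>i\<in>I. f i $ 0)"
  by (induction I rule: infinite_finite_induct) auto

lemma qpoch_nth_0: "A $ 0 = 0 \<Longrightarrow> qpoch A p m $ 0 = 1"
  by (simp add: qpoch_def fps_prod_nth_0)

lemma multisum_denominator_nth_0: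
  "((\<Prod>i=1..<r. qpoch qq qq (n i - n (i + 1))) * qpoch (qq ^ 2) qq (n r - 1)) $ 0 = 1"
  by (simp add: fps_prod_nth_0 qpoch_nth_0 power2_eq_square)

lemma qpoch_convergent:
  assumes "s \<ge> 1" "t \<ge> 1"
  shows "convergent_prod (\<lambda>i. 1 - qq ^ s * (qq ^ t) ^ i)"
    and "qpoch_inf (qq ^ s) (qq ^ t) $ 0 = 1"
proof -
  define f where "f = (\<lambda>i. 1 - qq ^ s * (qq ^ t) ^ i)"
  define P where "P = (\<lambda>n. \<Prod>i\<le>n. f i)"
  have step: "P (Suc n) $ m = P n $ m" if "m \<le> n" for n m
  proof -
    have "m < s + t * Suc n"
      using that assms mult_le_mono1[of 1 t "Suc n"] by simp
    moreover have "P (Suc n) = P n - qq ^ (s + t * Suc n) * P n"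
      by (simp only: P_def prod.atMost_Suc f_def power_mult power_add) (simp add: algebra_simps)
    ultimately show ?thesis
      by (simp add: fps_X_power_mult_nth)
  qed
  have stab: "P n $ m = P m $ m" if "m \<le> n" for n m
    using that by (induction n rule: dec_induct) (use step in auto)
  define L where "L = Abs_fps (\<lambda>m. P m $ m)"
  have lim: "P \<longlonglongrightarrow> L"
  proof (rule tendsto_fpsI)
    fix m
    show "\<forall>\<^sub>F n in sequentially. P n $ m = L $ m"
      using eventually_ge_at_top[of m]
    proof eventually_elim
      case (elim n)
      then show ?case using stab[OF elim] by (simp only: L_def fps_nth_Abs_fps)
    qed
  qed
  have L0: "L $ 0 = 1"
    using assms by (simp add: L_def P_def f_def)
  then have "L \<noteq> 0" by auto
  with lim have raw: "raw_has_prod f 0 L"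
    by (simp add: raw_has_prod_def P_def)
  then show "convergent_prod (\<lambda>i. 1 - qq ^ s * (qq ^ t) ^ i)"
    unfolding convergent_prod_def f_def by blast
  from raw have "f has_prod L"
    by (simp add: has_prod_def)
  then have "prodinf f = L"
    by (rule has_prod_unique[symmetric])
  then show "qpoch_inf (qq ^ s) (qq ^ t) $ 0 = 1"
    using L0 by (simp add: qpoch_inf_def f_def)
qed

lemma summable_on_fpsI:
  fixes F :: "'i \<Rightarrow> int poly fps"
  assumes "\<And>m. finite {n\<in>S. F n $ m \<noteq> 0}"
  shows "F summable_on S"
  unfolding summable_on_def
  by (rule exI[of _ "Abs_fps (\<lambda>m. \<Sum>n | n \<in> S \<and> F n $ m \<noteq> 0. F n $ m)"], rule has_sum_fpsI)
     (use assms in auto)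

lemma power_quot_nth_eq_0: "m < e \<Longrightarrow> ((qq ^ e /\<^sub>q g) * h) $ m = 0"
  by (simp add: fps_quot_def mult.assoc fps_X_power_mult_nth)

lemma single_sum_summable:
  "(\<lambda>n. (qq ^ (n ^ 2 + B_exp k a n) /\<^sub>q qpoch (qq ^ 2) qq (n - 1)) * h) summable_on {2..}"
proof (rule summable_on_fpsI)
  fix m
  have "n \<le> m"
    if "((qq ^ (n ^ 2 + B_exp k a n) /\<^sub>q qpoch (qq ^ 2) qq (n - 1)) * h) $ m \<noteq> 0" for n
  proof -
    have "n ^ 2 + B_exp k a n \<le> m"
      using that power_quot_nth_eq_0 by (metis not_le)
    moreover have "n \<le> n ^ 2"
      by (simp add: power2_eq_square)
    ultimately show ?thesis by linarith
  qed
  then have "{n \<in> {2..}.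
      ((qq ^ (n ^ 2 + B_exp k a n) /\<^sub>q qpoch (qq ^ 2) qq (n - 1)) * h) $ m \<noteq> 0} \<subseteq> {..m}"
    by blast
  then show "finite {n \<in> {2..}.
      ((qq ^ (n ^ 2 + B_exp k a n) /\<^sub>q qpoch (qq ^ 2) qq (n - 1)) * h) $ m \<noteq> 0}"
    by (rule finite_subset) simp
qed

lemma multisum_summable:
  "(\<lambda>n. multisum_term k a r n * h) summable_on decr_tuples r"
proof (rule summable_on_fpsI)
  fix m
  have "n \<in> {1..r} \<rightarrow>\<^sub>E {..m}"
    if n: "n \<in> decr_tuples r" and nz: "(multisum_term k a r n * h) $ m \<noteq> 0" for n
  proof -
    have e: "(\<Sum>i=1..r. n i ^ 2) + (\<Sum>i=k+1-a..r. n i) \<le> m"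
      using nz unfolding multisum_term_def
      by (rule contrapos_np) (rule power_quot_nth_eq_0, simp only: not_le)
    have "n i \<le> m" if "i \<in> {1..r}" for i
    proof -
      have "n i \<le> n i ^ 2"
        by (simp add: power2_eq_square)
      also have "\<dots> \<le> (\<Sum>i=1..r. n i ^ 2)"
        using that by (intro member_le_sum) auto
      finally show ?thesis using e by linarith
    qed
    then show ?thesis
      using n by (auto simp: decr_tuples_def PiE_iff)
  qed
  then have "{n \<in> decr_tuples r. (multisum_term k a r n * h) $ m \<noteq> 0} \<subseteq> {1..r} \<rightarrow>\<^sub>E {..m}"
    by blast
  then show "finite {n \<in> decr_tuples r. (multisum_term k a r n * h) $ m \<noteq> 0}"
    by (rule finite_subset) (intro finite_PiE, auto)
qed

end

theory Submission
  imports Defs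
begin

text \<open>
  The theorem is \<open>(1 - q^M) / (1 - x q^M)\<close> times the Andrews--Gordon identity
  \[ \frac{(q^{k+1-a},q^{k+2+a},q^{2k+3};q^{2k+3})_\infty}{(q;q)_\infty}
     = \sum_{n_1\ge\cdots\ge n_k\ge0}
       \frac{q^{n_1^2+\cdots+n_k^2+n_{k+1-a}+\cdots+n_k}}{(q)_{n_1-n_2}\cdots(q)_{n_{k-1}-n_k}(q)_{n_k}} \]
  with its right-hand side split by the number \<open>r\<close> of positive entries of the tuple.  The zero tuple
  contributes 1 to the sum and the tuple whose only positive entry is \<open>n\<^sub>1 = 1\<close> contributes
  \<open>q^(1+B) / (1 - q)\<close>; after multiplication by \<open>(1 - q^M) / (1 - x q^M)\<close> these two terms together are
  \<open>1 + A\<close> (\<open>A_term_absorbs\<close>).  In the other terms \<open>(q)\<^sub>n = (1 - q) (q^2;q)\<^sub>n\<^sub>-\<^sub>1\<close> for the last entry \<open>n\<close>, and the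
  factor \<open>1 - q\<close> turns \<open>1 - q^M\<close> into \<open>[M]\<^sub>q\<close>.

  The Andrews--Gordon identity is proved with a Bailey chain.  For \<open>e \<in> {0, 1}\<close> put
  \<open>\<beta>\<^sub>N = \<Sum>\<^sub>j c\<^sub>j / ((q)\<^sub>N\<^sub>-\<^sub>j (q)\<^sub>N\<^sub>+\<^sub>j\<^sub>+\<^sub>e)\<close>, the sum running over all integers \<open>j\<close>.  The \<open>q\<close>-Vandermonde
  sum shows that passing from \<open>\<beta>\<^sub>N\<close> to \<open>\<Sum>\<^sub>s q^(s^2+es) \<beta>\<^sub>s / (q)\<^sub>N\<^sub>-\<^sub>s\<close> multiplies \<open>c\<^sub>j\<close> by \<open>q^(j^2+ej)\<close>
  (\<open>bailey_lemma\<close>), so each step adds one summation variable on one side and changes only an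
  exponent on the other.  The chain starts from \<open>c\<^sub>j = (-1)^j q^(j(j-1)/2)\<close> with \<open>e = 1\<close>, for which
  \<open>\<beta>\<^sub>N\<close> is 1 at \<open>N = 0\<close> and 0 elsewhere (\<open>unit_bailey_pair\<close>).  Because of this
  the variable of the first step can only be 0, and \<open>k + 1\<close> steps produce \<open>k\<close> genuine variables and a
  final \<open>1 / (q)\<close>.  The first \<open>a + 1\<close> steps use \<open>e = 1\<close>, which gives the \<open>a\<close> linear terms in the
  exponent; then \<open>e = 1\<close> is exchanged for \<open>e = 0\<close> at no cost
  (\<open>bailey_lattice_step\<close>), and the other \<open>k - a\<close> steps use \<open>e = 0\<close>.  Letting \<open>N\<close> tend to infinity gives
  \<open>1 / (q)\<^sub>\<infinity>\<close> times the theta series \<open>\<Sum>\<^sub>j (-1)^j q^((2k+3)j(j-1)/2 + (k+a+2)j)\<close>, which the Jacobi triple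
  product turns into the infinite product (\<open>gordon_limit\<close>, \<open>andrews_gordon\<close>).
\<close>

section \<open>The topology on formal power series\<close>

text \<open>
  Since a coefficient of a sum or a product depends on finitely many coefficients of the
  arguments, both operations are continuous for coefficientwise stabilisation.  The two
  instances make the general theory of limits and infinite sums applicable.
\<close>

instance fps :: (ab_group_add) topological_comm_monoid_add
proof
  fix a b :: "'a fps"
  show "((\<lambda>x. fst x + snd x) \<longlongrightarrow> a + b) (nhds a \<times>\<^sub>F nhds b)"
  proof (rule tendsto_fpsI)
    fix m
    have "\<forall>\<^sub>F x in nhds c. x $ m = c $ m" for c :: "'a fps"
      using filterlim_ident[of "nhds c"] by (auto simp: tendsto_fps_iff)
    then have "\<forall>\<^sub>F x in nhds a \<times>\<^sub>F nhds b. fst x $ m = a $ m \<and> snd x $ m = b $ m"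
      unfolding eventually_prod_filter by fastforce
    then show "\<forall>\<^sub>F x in nhds a \<times>\<^sub>F nhds b. (fst x + snd x) $ m = (a + b) $ m"
      by eventually_elim simp
  qed
qed

instance fps :: (ring) topological_semigroup_mult
proof
  fix a b :: "'a fps"
  show "((\<lambda>x. fst x * snd x) \<longlongrightarrow> a * b) (nhds a \<times>\<^sub>F nhds b)"
  proof (rule tendsto_fpsI)
    fix m
    have "\<forall>\<^sub>F x in nhds c. \<forall>i\<in>{..m}. x $ i = c $ i" for c :: "'a fps"
      using filterlim_ident[of "nhds c"]
      by (intro eventually_ball_finite) (auto simp: tendsto_fps_iff)
    then have "\<forall>\<^sub>F x in nhds a \<times>\<^sub>F nhds b.
        (\<forall>i\<in>{..m}. fst x $ i = a $ i) \<and> (\<forall>i\<in>{..m}. snd x $ i = b $ i)"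
      unfolding eventually_prod_filter by fastforce
    then show "\<forall>\<^sub>F x in nhds a \<times>\<^sub>F nhds b. (fst x * snd x) $ m = (a * b) $ m"
      by eventually_elim (simp add: fps_mult_nth)
  qed
qed

text \<open>
  Addition does not increase the ultrametric distance.  Uniform continuity is what Fubini's
  theorem for infinite sums asks of addition.
\<close>

lemma uniformly_continuous_fps_add:
  "uniformly_continuous_on UNIV (\<lambda>(f :: 'a :: ab_group_add fps, g). f + g)"
proof -
  have ultra: "dist (f + g) (f' + g') \<le> max (dist f f') (dist g g')" for f g f' g' :: "'a fps"
  proof (cases "f + g = f' + g'")
    case False
    have eq: "f + g - (f' + g') = (f - f') + (g - g')"
      by (simp add: algebra_simps)
    with False have nz: "(f - f') + (g - g') \<noteq> 0"
      by (metis eq_iff_diff_eq_0)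
    show ?thesis
    proof (cases "f = f' \<or> g = g'")
      case True
      then show ?thesis by (auto simp: dist_fps_def)
    next
      case neq: False
      have "min (subdegree (f - f')) (subdegree (g - g')) \<le> subdegree (f + g - (f' + g'))"
        unfolding eq using nz by (rule subdegree_add_ge')
      then show ?thesis
        using neq False by (auto simp: dist_fps_def min_def max_def le_imp_inverse_le split: if_splits)
    qed
  qed (auto simp: le_max_iff_disj)
  show ?thesis
    unfolding uniformly_continuous_on_def
  proof (intro allI impI)
    fix e :: real assume "e > 0"
    have "dist (f' + g') (f + g) < e" if "dist (f', g') (f, g) < e" for f g f' g' :: "'a fps"
      using ultra[of f' g' f g] that dist_fst_le[of "(f', g')" "(f, g)"]
        dist_snd_le[of "(f', g')" "(f, g)"] by auto
    then show "\<exists>d>0. \<forall>x\<in>UNIV. \<forall>x'\<in>UNIV. dist x' x < d \<longrightarrow>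
        dist (case x' of (f, g) \<Rightarrow> f + g) (case x of (f, g) \<Rightarrow> (f + g :: 'a fps)) < e"
      using \<open>e > 0\<close> by (intro exI[of _ e]) auto
  qed
qed

lemma infsum_fps_nth:
  fixes F :: "'i \<Rightarrow> 'a :: ab_group_add fps"
  assumes "F summable_on S" "finite A" "A \<subseteq> S" "\<And>i. i \<in> S - A \<Longrightarrow> F i $ m = 0"
  shows "infsum F S $ m = (\<Sum>i\<in>A. F i $ m)"
proof -
  have "infsum F S $ m = (\<Sum>i | i \<in> S \<and> F i $ m \<noteq> 0. F i $ m)"
    by (rule has_sum_fpsD(2)) (rule has_sum_infsum[OF assms(1)])
  also have "\<dots> = (\<Sum>i\<in>A. F i $ m)"
    by (rule sum.mono_neutral_left) (use assms in auto)
  finally show ?thesis .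
qed

lemma fps_mult_nth_eq_0: "(\<And>l. l \<le> m \<Longrightarrow> f $ l = 0) \<Longrightarrow> (f * g) $ m = (0 :: 'a :: semiring_0)"
  by (auto simp: fps_mult_nth intro!: sum.neutral)

text \<open>
  A Tannery theorem: only the finitely many indices \<open>i\<close> for which \<open>c i\<close> has a nonzero coefficient up
  to order \<open>m\<close> can affect the \<open>m\<close>-th coefficient, whatever the other factor is, so the limit may be
  taken under the sum.
\<close>

lemma tannery_fps:
  fixes c :: "'i \<Rightarrow> int poly fps"
  assumes small: "\<And>m. finite {i \<in> S. \<exists>l\<le>m. c i $ l \<noteq> 0}"
    and lim: "\<And>i. i \<in> S \<Longrightarrow> (\<lambda>N. f N i) \<longlonglongrightarrow> L"
  shows "(\<lambda>N. \<Sum>\<^sub>\<infinity>i\<in>S. c i * f N i) \<longlonglongrightarrow> (\<Sum>\<^sub>\<infinity>i\<in>S. c i) * L"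
proof (rule tendsto_fpsI)
  fix m
  define A where "A = {i \<in> S. \<exists>l\<le>m. c i $ l \<noteq> 0}"
  have fin: "finite A" and sub: "A \<subseteq> S"
    using small[of m] by (auto simp: A_def)
  have vanish: "(c i * h) $ m = 0" if "i \<in> S - A" for i h
    using that by (intro fps_mult_nth_eq_0) (auto simp: A_def)
  have summ: "(\<lambda>i. c i * h i) summable_on S" for h
  proof (rule summable_on_fpsI)
    fix n
    have "{i \<in> S. (c i * h i) $ n \<noteq> 0} \<subseteq> {i \<in> S. \<exists>l\<le>n. c i $ l \<noteq> 0}"
      using fps_mult_nth_eq_0 by blast
    then show "finite {i \<in> S. (c i * h i) $ n \<noteq> 0}"
      using small finite_subset by blast
  qed
  have "\<forall>\<^sub>F N in sequentially. \<forall>i\<in>A. \<forall>l\<in>{..m}. f N i $ l = L $ l"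
    using lim sub fin by (intro eventually_ball_finite ballI) (auto simp: tendsto_fps_iff)
  then show "\<forall>\<^sub>F N in sequentially. (\<Sum>\<^sub>\<infinity>i\<in>S. c i * f N i) $ m = ((\<Sum>\<^sub>\<infinity>i\<in>S. c i) * L) $ m"
  proof eventually_elim
    case (elim N)
    have "(\<Sum>\<^sub>\<infinity>i\<in>S. c i * f N i) $ m = (\<Sum>i\<in>A. (c i * f N i) $ m)"
      by (rule infsum_fps_nth) (use summ fin sub vanish in auto)
    also have "\<dots> = (\<Sum>i\<in>A. (c i * L) $ m)"
      using elim by (intro sum.cong) (auto simp: fps_mult_nth)
    also have "\<dots> = (\<Sum>\<^sub>\<infinity>i\<in>S. c i * L) $ m"
      by (rule infsum_fps_nth[symmetric]) (use summ[of "\<lambda>_. L"] fin sub vanish in auto)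
    also have "(\<Sum>\<^sub>\<infinity>i\<in>S. c i * L) = (\<Sum>\<^sub>\<infinity>i\<in>S. c i) * L"
      by (rule infsum_cmult_left) (use summ[of "\<lambda>_. 1"] in simp)
    finally show ?case .
  qed
qed

section \<open>Reciprocal q-factorials and two finite summations\<close>

lemma fps_quot_eqI:
  assumes "g $ 0 = 1" "f = h * g"
  shows "f /\<^sub>q g = h"
proof -
  have "g * fps_right_inverse g 1 = 1"
    by (rule fps_right_inverse) (simp add: assms)
  then show ?thesis
    by (simp add: assms(2) fps_quot_def mult.assoc)
qed

text \<open>
  The value 0 at negative arguments is the usual convention for \<open>1 / (p;p)\<^sub>n\<close>.  It cuts off sums at
  their natural bounds and makes the recurrence \<open>inv_qpoch_step\<close> hold at \<open>n = 0\<close> too.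
\<close>

definition inv_qpoch :: "int poly fps \<Rightarrow> int \<Rightarrow> int poly fps" where
  "inv_qpoch p n = (if n < 0 then 0 else 1 /\<^sub>q qpoch p p (nat n))"

lemma inv_qpoch_neg [simp]: "n < 0 \<Longrightarrow> inv_qpoch p n = 0"
  by (simp add: inv_qpoch_def)

lemma inv_qpoch_0 [simp]: "inv_qpoch p 0 = 1"
  by (simp add: inv_qpoch_def qpoch_def fps_quot_eqI)

lemma inv_qpoch_mult_qpoch: "p $ 0 = 0 \<Longrightarrow> inv_qpoch p (int n) * qpoch p p n = 1"
  by (simp add: inv_qpoch_def fps_quot_mult qpoch_nth_0)

lemma inv_qpoch_step:
  assumes "p $ 0 = 0" "n \<ge> 0"
  shows "(1 - p ^ nat n) * inv_qpoch p n = inv_qpoch p (n - 1)"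
proof (cases "n = 0")
  case False
  with assms obtain m where m: "n = int (Suc m)"
    by (metis nonneg_int_cases int_nat_eq nat_0_iff of_nat_0 not0_implies_Suc)
  have "inv_qpoch p (int m) = inv_qpoch p (int m) * (inv_qpoch p (int (Suc m)) * qpoch p p (Suc m))"
    using assms by (simp only: inv_qpoch_mult_qpoch) simp
  also have "\<dots> = (inv_qpoch p (int m) * qpoch p p m) * (inv_qpoch p (int (Suc m)) * (1 - p ^ Suc m))"
    by (simp add: qpoch_def mult_ac)
  finally show ?thesis
    using assms by (simp only: inv_qpoch_mult_qpoch) (simp add: m mult_ac nat_add_distrib)
qed simp

lemma inv_qpoch_Suc: "p $ 0 = 0 \<Longrightarrow> (1 - p ^ Suc n) * inv_qpoch p (int (Suc n)) = inv_qpoch p (int n)"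
  using inv_qpoch_step[of p "int (Suc n)"] by (simp add: nat_add_distrib)

lemma one_minus_power_nonzero:
  assumes "p $ 0 = (0 :: int poly)" "n > 0"
  shows "1 - p ^ n \<noteq> 0"
proof
  assume "1 - p ^ n = 0"
  then have "(1 - p ^ n) $ 0 = 0" by simp
  then show False using assms by (simp add: fps_power_zeroth power_0_left)
qed

text \<open>
  The \<open>q\<close>-binomial theorem, homogeneous in \<open>x\<close> and \<open>y\<close> so that shifts such as \<open>x = p^(-N)\<close> can be
  expressed without negative powers.  The induction multiplies by \<open>1 - p^(n+1)\<close> and uses
  \<open>1 - p^(n+1) = (1 - p^(n+1-m)) + p^(n+1-m) (1 - p^m)\<close>: by the recurrence for the reciprocal
  factorials the two parts give \<open>y\<close> and \<open>- x p^n\<close> times the sum for \<open>n\<close>.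
\<close>

lemma q_binomial:
  fixes x y :: "int poly fps"
  assumes p: "p $ 0 = 0"
  shows "(\<Sum>m\<le>n. (-1) ^ m * p ^ (m choose 2) * x ^ m * y ^ (n - m) * inv_qpoch p (int m) * inv_qpoch p (int n - int m))
         = inv_qpoch p (int n) * (\<Prod>i<n. y - x * p ^ i)"
proof (induction n)
  case (Suc n)
  let ?g = "\<lambda>n m. (-1) ^ m * p ^ (m choose 2) * x ^ m * y ^ (n - m) * inv_qpoch p (int m) * inv_qpoch p (int n - int m)"
  have split: "(1 - p ^ Suc n) * ?g (Suc n) m =
      y * (if m \<le> n then ?g n m else 0)
      + (case m of 0 \<Rightarrow> 0 | Suc u \<Rightarrow> - x * p ^ n * ?g n u)" if m: "m \<le> Suc n" for m
  proof -
    have low: "(1 - p ^ (Suc n - m)) * inv_qpoch p (int (Suc n) - int m) = inv_qpoch p (int n - int m)"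
      using inv_qpoch_step[OF p, of "int (Suc n) - int m"] m
      by (simp add: nat_diff_distrib' nat_add_distrib)
    have 1: "(1 - p ^ (Suc n - m)) * ?g (Suc n) m = y * (if m \<le> n then ?g n m else 0)"
    proof (cases "m \<le> n")
      case True
      have "(1 - p ^ (Suc n - m)) * ?g (Suc n) m =
         (-1) ^ m * p ^ (m choose 2) * x ^ m * y ^ (Suc n - m) * inv_qpoch p (int m) *
         ((1 - p ^ (Suc n - m)) * inv_qpoch p (int (Suc n) - int m))"
        by (simp only: mult_ac)
      then show ?thesis using True by (simp only: low) (simp add: Suc_diff_le)
    qed (use m in \<open>simp add: not_le\<close>)
    have 2: "p ^ (Suc n - m) * (1 - p ^ m) * ?g (Suc n) m
        = (case m of 0 \<Rightarrow> 0 | Suc u \<Rightarrow> - x * p ^ n * ?g n u)"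
    proof (cases m)
      case (Suc u)
      have up: "(1 - p ^ Suc u) * inv_qpoch p (int (Suc u)) = inv_qpoch p (int u)"
        by (rule inv_qpoch_Suc[OF p])
      have "p ^ (Suc n - m) * p ^ (m choose 2) = p ^ n * p ^ (u choose 2)"
        using m by (simp add: Suc numeral_2_eq_2 flip: power_add)
      moreover have "p ^ (Suc n - m) * (1 - p ^ m) * ?g (Suc n) m =
         (p ^ (Suc n - m) * p ^ (m choose 2)) * (-1) ^ m  * x ^ m * y ^ (Suc n - m) *
         ((1 - p ^ m) * inv_qpoch p (int m)) * inv_qpoch p (int (Suc n) - int m)"
        by (simp only: mult_ac)
      ultimately show ?thesis
        by (simp only: Suc up) (simp add: mult_ac)
    qed simp
    have "p ^ Suc n = p ^ (Suc n - m) * p ^ m"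
      using m by (simp flip: power_add)
    then have "1 - p ^ Suc n = (1 - p ^ (Suc n - m)) + p ^ (Suc n - m) * (1 - p ^ m)"
      by (simp add: algebra_simps)
    then show ?thesis
      by (simp only: distrib_right 1 2)
  qed
  have "(1 - p ^ Suc n) * (\<Sum>m\<le>Suc n. ?g (Suc n) m) =
      (\<Sum>m\<le>Suc n. y * (if m \<le> n then ?g n m else 0))
      + (\<Sum>m\<le>Suc n. case m of 0 \<Rightarrow> 0 | Suc u \<Rightarrow> - x * p ^ n * ?g n u)"
    unfolding sum_distrib_left sum.distrib[symmetric] by (rule sum.cong) (use split in auto)
  also have "(\<Sum>m\<le>Suc n. y * (if m \<le> n then ?g n m else 0)) = y * (\<Sum>m\<le>n. ?g n m)"
    by (simp add: sum_distrib_left)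
  also have "(\<Sum>m\<le>Suc n. case m of 0 \<Rightarrow> 0 | Suc u \<Rightarrow> - x * p ^ n * ?g n u)
      = - x * p ^ n * (\<Sum>m\<le>n. ?g n m)"
    by (simp only: sum.atMost_Suc_shift sum_distrib_left) simp
  also have "y * (\<Sum>m\<le>n. ?g n m) + - x * p ^ n * (\<Sum>m\<le>n. ?g n m)
      = inv_qpoch p (int n) * (\<Prod>i<Suc n. y - x * p ^ i)"
    unfolding Suc.IH by (simp add: algebra_simps)
  also have "inv_qpoch p (int n) = (1 - p ^ Suc n) * inv_qpoch p (int (Suc n))"
    by (rule inv_qpoch_Suc[OF p, symmetric])
  finally show ?case
    using one_minus_power_nonzero[OF p, of "Suc n"] by (simp only: mult.assoc mult_cancel_left) simp
qed (simp add: numeral_2_eq_2)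

text \<open>
  A limiting case of the \<open>q\<close>-Vandermonde sum, by the same splitting of \<open>1 - p^(n+1)\<close>: the two
  parts give the sums for \<open>(n, m)\<close> and \<open>(n, m + 1)\<close>.
\<close>

lemma q_vandermonde:
  assumes p: "p $ 0 = 0"
  shows "(\<Sum>t\<le>n. p ^ (t * (t + m)) * inv_qpoch p (int t) * inv_qpoch p (int n - int t) * inv_qpoch p (int (t + m)))
         = inv_qpoch p (int n) * inv_qpoch p (int (n + m))"
proof (induction n arbitrary: m)
  case (Suc n)
  let ?g = "\<lambda>n m t. p ^ (t * (t + m)) * inv_qpoch p (int t) * inv_qpoch p (int n - int t) * inv_qpoch p (int (t + m))"
  have split: "(1 - p ^ Suc n) * ?g (Suc n) m t =
      ?g n m t
      + (case t of 0 \<Rightarrow> 0 | Suc u \<Rightarrow> p ^ (Suc n + m) * ?g n (Suc m) u)" if t: "t \<le> Suc n" for t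
  proof -
    have low: "(1 - p ^ (Suc n - t)) * inv_qpoch p (int (Suc n) - int t) = inv_qpoch p (int n - int t)"
      using inv_qpoch_step[OF p, of "int (Suc n) - int t"] t
      by (simp add: nat_diff_distrib' nat_add_distrib)
    have "(1 - p ^ (Suc n - t)) * ?g (Suc n) m t = p ^ (t * (t + m)) * inv_qpoch p (int t) *
        ((1 - p ^ (Suc n - t)) * inv_qpoch p (int (Suc n) - int t)) * inv_qpoch p (int (t + m))"
      by (simp only: mult_ac)
    then have 1: "(1 - p ^ (Suc n - t)) * ?g (Suc n) m t = ?g n m t"
      by (simp only: low)
    have 2: "p ^ (Suc n - t) * (1 - p ^ t) * ?g (Suc n) m t
        = (case t of 0 \<Rightarrow> 0 | Suc u \<Rightarrow> p ^ (Suc n + m) * ?g n (Suc m) u)"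
    proof (cases t)
      case (Suc u)
      have up: "(1 - p ^ Suc u) * inv_qpoch p (int (Suc u)) = inv_qpoch p (int u)"
        by (rule inv_qpoch_Suc[OF p])
      have "p ^ (Suc n - t) * p ^ (t * (t + m)) = p ^ (Suc n + m) * p ^ (u * (u + Suc m))"
        using t by (simp add: Suc algebra_simps flip: power_add)
      moreover have "p ^ (Suc n - t) * (1 - p ^ t) * ?g (Suc n) m t =
         (p ^ (Suc n - t) * p ^ (t * (t + m))) *
         ((1 - p ^ t) * inv_qpoch p (int t)) * inv_qpoch p (int (Suc n) - int t) * inv_qpoch p (int (t + m))"
        by (simp only: mult_ac)
      ultimately show ?thesis
        by (simp only: Suc up) (simp add: mult_ac)
    qed simp
    have "p ^ Suc n = p ^ (Suc n - t) * p ^ t"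
      using t by (simp flip: power_add)
    then have "1 - p ^ Suc n = (1 - p ^ (Suc n - t)) + p ^ (Suc n - t) * (1 - p ^ t)"
      by (simp add: algebra_simps)
    then show ?thesis
      by (simp only: distrib_right 1 2)
  qed
  have "(1 - p ^ Suc n) * (\<Sum>t\<le>Suc n. ?g (Suc n) m t) =
      (\<Sum>t\<le>Suc n. ?g n m t)
      + (\<Sum>t\<le>Suc n. case t of 0 \<Rightarrow> 0 | Suc u \<Rightarrow> p ^ (Suc n + m) * ?g n (Suc m) u)"
    unfolding sum_distrib_left sum.distrib[symmetric] by (rule sum.cong) (use split in auto)
  also have "(\<Sum>t\<le>Suc n. ?g n m t) = (\<Sum>t\<le>n. ?g n m t)"
    by simp
  also have "(\<Sum>t\<le>Suc n. case t of 0 \<Rightarrow> 0 | Suc u \<Rightarrow> p ^ (Suc n + m) * ?g n (Suc m) u)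
      = p ^ (Suc n + m) * (\<Sum>t\<le>n. ?g n (Suc m) t)"
    by (simp only: sum.atMost_Suc_shift sum_distrib_left) simp
  also have "(\<Sum>t\<le>n. ?g n m t) + p ^ (Suc n + m) * (\<Sum>t\<le>n. ?g n (Suc m) t)
      = inv_qpoch p (int n) * (inv_qpoch p (int (n + m)) + p ^ (Suc n + m) * inv_qpoch p (int (Suc n + m)))"
    unfolding Suc.IH by (simp add: algebra_simps)
  also have "inv_qpoch p (int (n + m)) = (1 - p ^ (Suc n + m)) * inv_qpoch p (int (Suc n + m))"
    using inv_qpoch_Suc[OF p, of "n + m"] by simp
  also have "inv_qpoch p (int n) = (1 - p ^ Suc n) * inv_qpoch p (int (Suc n))"
    by (rule inv_qpoch_Suc[OF p, symmetric])
  finally have "(1 - p ^ Suc n) * (\<Sum>t\<le>Suc n. ?g (Suc n) m t)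
      = (1 - p ^ Suc n) * (inv_qpoch p (int (Suc n)) * inv_qpoch p (int (Suc n + m)))"
    by (simp add: algebra_simps)
  then show ?case
    using one_minus_power_nonzero[OF p, of "Suc n"] by (simp only: mult_cancel_left) simp
qed simp

section \<open>Theta coefficients\<close>

text \<open>
  The series \<open>\<Sum>\<^sub>j theta_coeff t s j\<close> is the bilateral side of Jacobi's triple product with base \<open>q^t\<close>
  and argument \<open>q^s\<close>.  Every sequence \<open>c\<^sub>j\<close> in the Bailey chain belongs to this two-parameter family,
  because \<open>j^2 + e j = 2 (j(j-1)/2) + (1 + e) j\<close>.
\<close>

definition theta_exp :: "nat \<Rightarrow> nat \<Rightarrow> int \<Rightarrow> int" where
  "theta_exp t s j = int t * (j * (j - 1) div 2) + int s * j"

definition theta_coeff :: "nat \<Rightarrow> nat \<Rightarrow> int \<Rightarrow> int poly fps" where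
  "theta_coeff t s j = (if even j then 1 else - 1) * qq ^ nat (theta_exp t s j)"

lemma two_times_triangle: "2 * (j * (j - 1) div 2) = j * (j - 1 :: int)"
  by simp

lemma two_times_choose_two: "2 * int (m choose 2) = int m * (int m - 1)"
proof -
  have "even (m * (m - 1))"
    by (cases m) auto
  then have "2 * (m choose 2) = m * (m - 1)"
    by (simp add: choose_two)
  then have "int (2 * (m choose 2)) = int (m * (m - 1))"
    by (rule arg_cong)
  then show ?thesis
    by (cases m) (auto simp: algebra_simps)
qed

lemma two_times_theta_exp: "2 * theta_exp t s j = int t * (j * (j - 1)) + 2 * int s * j"
proof -
  have "2 * theta_exp t s j = int t * (2 * (j * (j - 1) div 2)) + 2 * int s * j"
    by (simp add: theta_exp_def algebra_simps)
  then show ?thesis by (simp only: two_times_triangle)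
qed

lemma two_times_theta_exp_split:
  assumes "s \<le> t"
  shows "2 * theta_exp t s j = int (t - s) * (j * (j - 1)) + int s * (j * (j + 1))"
  unfolding two_times_theta_exp using assms by (simp add: of_nat_diff algebra_simps)

lemma consecutive_product_nonneg: "j * (j - 1) \<ge> 0" "j * (j + 1) \<ge> (0 :: int)"
  by (cases "j \<ge> 1"; cases "j = 0"; auto intro: mult_nonneg_nonneg mult_nonpos_nonpos)+

lemma theta_exp_nonneg:
  assumes "s \<le> t"
  shows "theta_exp t s j \<ge> 0"
proof -
  have "2 * theta_exp t s j \<ge> 0"
    unfolding two_times_theta_exp_split[OF assms]
    by (intro add_nonneg_nonneg mult_nonneg_nonneg consecutive_product_nonneg) simp_all
  then show ?thesis by simp
qed

section \<open>The Bailey chain\<close>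

definition bailey_kernel :: "nat \<Rightarrow> nat \<Rightarrow> int \<Rightarrow> int poly fps" where
  "bailey_kernel e N j = inv_qpoch qq (int N - j) * inv_qpoch qq (int N + j + int e)"

text \<open>
  For \<open>e \<le> 1\<close> the kernel vanishes outside \<open>- N - 1 \<le> j \<le> N\<close>, so this is the sum over all integers.
\<close>

definition bailey_sum :: "nat \<Rightarrow> (int \<Rightarrow> int poly fps) \<Rightarrow> nat \<Rightarrow> int poly fps" where
  "bailey_sum e c N = (\<Sum>j\<in>{- int N - 1..int N}. c j * bailey_kernel e N j)"

lemma bailey_kernel_reflect: "bailey_kernel e N (- j - int e) = bailey_kernel e N j"
  by (simp add: bailey_kernel_def algebra_simps)

text \<open>
  For \<open>j \<ge> 0\<close> the substitution \<open>s = j + t\<close> reduces this to \<open>q_vandermonde\<close> with \<open>m = 2j + e\<close>.  Both sides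
  are invariant under \<open>j \<mapsto> - j - e\<close>, and for \<open>e \<le> 1\<close> this reflection sends every negative \<open>j\<close> to a
  nonnegative one.
\<close>

lemma bailey_kernel_step:
  assumes "e \<le> 1"
  shows "(\<Sum>s\<le>N. qq ^ (s ^ 2 + e * s) * inv_qpoch qq (int N - int s) * bailey_kernel e s j)
         = qq ^ nat (j ^ 2 + int e * j) * bailey_kernel e N j"
proof -
  have nonneg: "(\<Sum>s\<le>N. qq ^ (s ^ 2 + e * s) * inv_qpoch qq (int N - int s) * bailey_kernel e s (int i))
         = qq ^ (i ^ 2 + e * i) * bailey_kernel e N (int i)" for i
  proof (cases "i \<le> N")
    case True
    let ?f = "\<lambda>s. qq ^ (s ^ 2 + e * s) * inv_qpoch qq (int N - int s) * bailey_kernel e s (int i)"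
    have "(\<Sum>s\<le>N. ?f s) = (\<Sum>s\<in>{i..N}. ?f s)"
      by (rule sum.mono_neutral_right) (auto simp: bailey_kernel_def)
    also have "\<dots> = (\<Sum>t\<le>N - i. ?f (i + t))"
      by (rule sum.reindex_bij_witness[of _ "\<lambda>t. i + t" "\<lambda>s. s - i"]) (use True in auto)
    also have "\<dots> = (\<Sum>t\<le>N - i. qq ^ (i ^ 2 + e * i) * (qq ^ (t * (t + (2 * i + e))) * inv_qpoch qq (int t)
        * inv_qpoch qq (int (N - i) - int t) * inv_qpoch qq (int (t + (2 * i + e)))))"
    proof (rule sum.cong)
      fix t assume "t \<in> {..N - i}"
      have "(i + t) ^ 2 + e * (i + t) = i ^ 2 + e * i + t * (t + (2 * i + e))"
        by (simp add: power2_eq_square algebra_simps)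
      moreover have "bailey_kernel e (i + t) (int i) = inv_qpoch qq (int t) * inv_qpoch qq (int (t + (2 * i + e)))"
        by (simp add: bailey_kernel_def algebra_simps)
      moreover have "int N - int (i + t) = int (N - i) - int t"
        using True by simp
      ultimately show "?f (i + t) = qq ^ (i ^ 2 + e * i) * (qq ^ (t * (t + (2 * i + e))) * inv_qpoch qq (int t)
        * inv_qpoch qq (int (N - i) - int t) * inv_qpoch qq (int (t + (2 * i + e))))"
        by (simp only: power_add mult_ac)
    qed simp
    also have "\<dots> = qq ^ (i ^ 2 + e * i) * (inv_qpoch qq (int (N - i)) * inv_qpoch qq (int (N - i + (2 * i + e))))"
      unfolding sum_distrib_left[symmetric] by (subst q_vandermonde) simp_all
    also have "\<dots> = qq ^ (i ^ 2 + e * i) * bailey_kernel e N (int i)"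
      using True by (simp add: bailey_kernel_def algebra_simps of_nat_diff)
    finally show ?thesis .
  qed (simp add: bailey_kernel_def)
  show ?thesis
  proof (cases "j \<ge> 0")
    case True
    then obtain i where i: "j = int i" by (metis nonneg_int_cases)
    have "nat (j ^ 2 + int e * j) = i ^ 2 + e * i"
      unfolding i by (simp add: nat_int flip: of_nat_power of_nat_mult of_nat_add)
    then show ?thesis using nonneg[of i] by (simp add: i)
  next
    case False
    with assms have "- j - int e \<ge> 0" by simp
    then obtain i where i: "- j - int e = int i" by (metis nonneg_int_cases)
    have refl: "bailey_kernel e s j = bailey_kernel e s (int i)" for s
      unfolding i[symmetric] by (rule bailey_kernel_reflect[symmetric])
    have j: "j = - int i - int e" using i by simp
    have "j ^ 2 + int e * j = int (i ^ 2 + e * i)"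
      unfolding j by (simp add: power2_eq_square algebra_simps)
    then show ?thesis using nonneg[of i] by (simp only: refl nat_int)
  qed
qed

lemma bailey_sum_extend:
  assumes "N \<le> L" "e \<le> 1"
  shows "bailey_sum e c N = (\<Sum>j\<in>{- int L - 1..int L}. c j * bailey_kernel e N j)"
  unfolding bailey_sum_def
  by (rule sum.mono_neutral_left) (use assms in \<open>auto simp: bailey_kernel_def\<close>)

lemma bailey_lemma:
  assumes "e \<le> 1"
  shows "(\<Sum>s\<le>N. qq ^ (s ^ 2 + e * s) * inv_qpoch qq (int N - int s) * bailey_sum e c s)
         = bailey_sum e (\<lambda>j. qq ^ nat (j ^ 2 + int e * j) * c j) N"
proof -
  have "(\<Sum>s\<le>N. qq ^ (s ^ 2 + e * s) * inv_qpoch qq (int N - int s) * bailey_sum e c s)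
      = (\<Sum>s\<le>N. \<Sum>j\<in>{- int N - 1..int N}.
           c j * (qq ^ (s ^ 2 + e * s) * inv_qpoch qq (int N - int s) * bailey_kernel e s j))"
    by (rule sum.cong) (use assms in \<open>simp_all add: bailey_sum_extend[of _ N] sum_distrib_left mult_ac\<close>)
  also have "\<dots> = (\<Sum>j\<in>{- int N - 1..int N}. c j * (\<Sum>s\<le>N.
           qq ^ (s ^ 2 + e * s) * inv_qpoch qq (int N - int s) * bailey_kernel e s j))"
    by (subst sum.swap) (simp only: sum_distrib_left)
  also have "\<dots> = bailey_sum e (\<lambda>j. qq ^ nat (j ^ 2 + int e * j) * c j) N"
    unfolding bailey_kernel_step[OF assms] bailey_sum_def by (simp only: mult_ac)
  finally show ?thesis .
qed

text \<open>
  The family of theta coefficients is closed under Bailey steps: each step adds 2 to \<open>t\<close>, and adds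
  1 or 2 to \<open>s\<close> according to \<open>e\<close>.
\<close>

lemma bailey_step_theta:
  assumes "e \<le> 1" "s \<le> t"
  shows "(\<Sum>r\<le>N. qq ^ (r ^ 2 + e * r) * inv_qpoch qq (int N - int r) * bailey_sum e (theta_coeff t s) r)
         = bailey_sum e (theta_coeff (t + 2) (s + 1 + e)) N"
proof -
  have "qq ^ nat (j ^ 2 + int e * j) * theta_coeff t s j = theta_coeff (t + 2) (s + 1 + e) j" for j
  proof -
    have "j ^ 2 + int e * j \<ge> 0"
    proof (cases "j \<ge> 0")
      case False
      then have "0 \<le> - j * (- j - int e)" using assms by (intro mult_nonneg_nonneg) auto
      then show ?thesis by (simp add: power2_eq_square algebra_simps)
    qed simp
    moreover have "j ^ 2 + int e * j + theta_exp t s j = theta_exp (t + 2) (s + 1 + e) j"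
      using two_times_theta_exp[of t s j] two_times_theta_exp[of "t + 2" "s + 1 + e" j]
      by (simp add: power2_eq_square algebra_simps)
    ultimately have "nat (j ^ 2 + int e * j) + nat (theta_exp t s j)
        = nat (theta_exp (t + 2) (s + 1 + e) j)"
      using theta_exp_nonneg[OF assms(2), of j] by (simp flip: nat_add_distrib)
    then show ?thesis
      by (simp add: theta_coeff_def flip: power_add)
  qed
  then show ?thesis by (subst bailey_lemma) (use assms in simp_all)
qed

text \<open>
  For \<open>N > 0\<close> this is the \<open>q\<close>-binomial theorem with \<open>2N + 1\<close> factors at \<open>x = q\<close>, \<open>y = q^N\<close>, read with
  \<open>m = N - j\<close>: the product contains the factor \<open>q^N - q q^(N-1) = 0\<close>.
\<close>

lemma unit_bailey_pair: "bailey_sum 1 (theta_coeff 1 0) N = (if N = 0 then 1 else 0)"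
proof (cases "N = 0")
  case True
  have "{- 1..0} = {- 1, 0 :: int}" by auto
  then have "bailey_sum 1 (theta_coeff 1 0) 0 = (1 - qq) * inv_qpoch qq 1"
    by (simp add: bailey_sum_def bailey_kernel_def theta_coeff_def theta_exp_def algebra_simps)
  also have "\<dots> = 1" using inv_qpoch_step[of qq 1] by simp
  finally show ?thesis using True by simp
next
  case False
  \<comment> \<open>the power of \<open>q\<close> by which the homogeneous \<open>q\<close>-binomial sum exceeds the bilateral one\<close>
  let ?C = "3 * (Suc N choose 2)"
  let ?n = "2 * N + 1"
  let ?g = "\<lambda>m. (-1) ^ m * qq ^ (m choose 2) * qq ^ m * (qq ^ N) ^ (?n - m)
      * inv_qpoch qq (int m) * inv_qpoch qq (int ?n - int m)"
  have term_eq: "?g m = (-1) ^ N * qq ^ ?C * (theta_coeff 1 0 (int N - int m) * bailey_kernel 1 N (int N - int m))"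
    if m: "m \<le> ?n" for m
  proof -
    let ?j = "int N - int m"
    have diff: "int (?n - m) = int ?n - int m" using m by simp
    have "2 * (int (m choose 2) + int m + int N * int (?n - m)) = 2 * (3 * int (Suc N choose 2) + theta_exp 1 0 ?j)"
      using two_times_theta_exp[of 1 0 ?j] two_times_choose_two[of m] two_times_choose_two[of "Suc N"]
      unfolding diff by (simp add: algebra_simps)
    then have "int ((m choose 2) + m + N * (?n - m)) = int ?C + theta_exp 1 0 ?j"
      by simp
    then have "(m choose 2) + m + N * (?n - m) = ?C + nat (theta_exp 1 0 ?j)"
      using theta_exp_nonneg[of 0 1 ?j] by linarith
    then have "qq ^ (m choose 2) * qq ^ m * (qq ^ N) ^ (?n - m) = qq ^ ?C * qq ^ nat (theta_exp 1 0 ?j)"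
      by (simp only: power_mult[symmetric] power_add[symmetric])
    moreover have "(-1) ^ m = (-1) ^ N * (if even ?j then 1 else - 1 :: int poly fps)"
      by (cases "even N"; cases "even m") auto
    moreover have "bailey_kernel 1 N ?j = inv_qpoch qq (int m) * inv_qpoch qq (int ?n - int m)"
      by (simp add: bailey_kernel_def algebra_simps)
    moreover have "?g m = (-1) ^ m * (qq ^ (m choose 2) * qq ^ m * (qq ^ N) ^ (?n - m))
        * (inv_qpoch qq (int m) * inv_qpoch qq (int ?n - int m))"
      by (simp only: mult.assoc)
    ultimately have "?g m = (-1) ^ N * (if even ?j then 1 else - 1) * (qq ^ ?C * qq ^ nat (theta_exp 1 0 ?j))
        * bailey_kernel 1 N ?j"
      by (simp only:)
    then show ?thesis
      by (simp only: theta_coeff_def mult_ac)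
  qed
  have "(\<Sum>m\<le>?n. ?g m) = inv_qpoch qq (int ?n) * (\<Prod>i<?n. qq ^ N - qq * qq ^ i)"
    by (rule q_binomial) simp
  also have "(\<Prod>i<?n. qq ^ N - qq * qq ^ i) = 0"
    by (rule prod_zero) (use False in \<open>auto intro!: bexI[of _ "N - 1"] simp flip: power_Suc\<close>)
  finally have "0 = (\<Sum>m\<le>?n. ?g m)" by simp
  also have "\<dots> = (\<Sum>m\<le>?n. (-1) ^ N * qq ^ ?C *
      (theta_coeff 1 0 (int N - int m) * bailey_kernel 1 N (int N - int m)))"
    by (rule sum.cong) (use term_eq in auto)
  also have "\<dots> = (-1) ^ N * qq ^ ?C * (\<Sum>m\<le>?n. theta_coeff 1 0 (int N - int m) * bailey_kernel 1 N (int N - int m))"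
    by (simp only: sum_distrib_left)
  also have "(\<Sum>m\<le>?n. theta_coeff 1 0 (int N - int m) * bailey_kernel 1 N (int N - int m))
      = bailey_sum 1 (theta_coeff 1 0) N"
    unfolding bailey_sum_def
    by (rule sum.reindex_bij_witness[of _ "\<lambda>j. nat (int N - j)" "\<lambda>m. int N - int m"]) auto
  finally show ?thesis using False by simp
qed

text \<open>
  The two sums differ by \<open>D = \<Sum>\<^sub>j c\<^sub>j q^(N+j+1) / ((q)\<^sub>N\<^sub>-\<^sub>j (q)\<^sub>N\<^sub>+\<^sub>j\<^sub>+\<^sub>1)\<close>.  The kernel is invariant under
  \<open>j \<mapsto> - 1 - j\<close>, while \<open>s = t - 1\<close> is exactly the case in which \<open>c\<^sub>j q^j\<close> changes sign under it; hence
  \<open>D = - D\<close>.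
\<close>

lemma bailey_lattice_step:
  assumes "t \<ge> 1"
  shows "bailey_sum 1 (theta_coeff t (t - 1)) N = bailey_sum 0 (theta_coeff t (t - 1)) N"
proof -
  let ?c = "theta_coeff t (t - 1)" and ?J = "{- int N - 1..int N}"
  define D where "D = (\<Sum>j\<in>?J. ?c j * qq ^ nat (int N + j + 1) * bailey_kernel 1 N j)"
  have kernel: "bailey_kernel 0 N j = bailey_kernel 1 N j - qq ^ nat (int N + j + 1) * bailey_kernel 1 N j" if "j \<in> ?J" for j
  proof -
    have "bailey_kernel 0 N j = inv_qpoch qq (int N - j) * ((1 - qq ^ nat (int N + j + 1)) * inv_qpoch qq (int N + j + 1))"
      using that by (subst inv_qpoch_step) (simp_all add: bailey_kernel_def)
    then show ?thesis by (simp add: bailey_kernel_def algebra_simps)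
  qed
  have "bailey_sum 0 ?c N = bailey_sum 1 ?c N - D"
    unfolding bailey_sum_def D_def sum_subtractf[symmetric]
    by (intro sum.cong refl, simp only: kernel) (simp only: algebra_simps)
  moreover have "D = - D"
  proof -
    have "D = (\<Sum>j\<in>?J. ?c (- 1 - j) * qq ^ nat (int N - j) * bailey_kernel 1 N (- 1 - j))"
      unfolding D_def by (rule sum.reindex_bij_witness[of _ "\<lambda>j. - 1 - j" "\<lambda>j. - 1 - j"]) (auto simp: algebra_simps)
    also have "\<dots> = (\<Sum>j\<in>?J. - (?c j * qq ^ nat (int N + j + 1) * bailey_kernel 1 N j))"
    proof (rule sum.cong)
      fix j assume j: "j \<in> ?J"
      have "2 * (theta_exp t (t - 1) (- 1 - j) + (int N - j)) = 2 * (theta_exp t (t - 1) j + (int N + j + 1))"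
        unfolding distrib_left two_times_theta_exp using assms by (simp add: of_nat_diff algebra_simps)
      then have "nat (theta_exp t (t - 1) (- 1 - j)) + nat (int N - j)
          = nat (theta_exp t (t - 1) j) + nat (int N + j + 1)"
        using j theta_exp_nonneg[of "t - 1" t j] theta_exp_nonneg[of "t - 1" t "- 1 - j"]
        by (simp flip: nat_add_distrib)
      then have "qq ^ nat (theta_exp t (t - 1) (- 1 - j)) * qq ^ nat (int N - j)
          = qq ^ nat (theta_exp t (t - 1) j) * qq ^ nat (int N + j + 1)"
        by (simp only: power_add[symmetric])
      moreover have "bailey_kernel 1 N (- 1 - j) = bailey_kernel 1 N j"
        using bailey_kernel_reflect[of 1 N j] by (simp only: of_nat_1 minus_diff_commute[of j])
      moreover have "(if even (- 1 - j) then 1 else - 1) = - (if even j then 1 else - 1 :: int poly fps)"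
        by simp
      ultimately show "?c (- 1 - j) * qq ^ nat (int N - j) * bailey_kernel 1 N (- 1 - j)
          = - (?c j * qq ^ nat (int N + j + 1) * bailey_kernel 1 N j)"
        unfolding theta_coeff_def by (simp only: mult.assoc) simp
    qed simp
    finally show ?thesis by (simp add: D_def sum_negf)
  qed
  then have "2 * D = 0" by (metis eq_neg_iff_add_eq_0 mult_2)
  then have "D = 0" by simp
  ultimately show ?thesis by simp
qed

section \<open>Infinite products and Jacobi's triple product\<close>

lemma tendsto_fps_quot_one:
  assumes "f \<longlonglongrightarrow> g" "\<And>n. f n $ 0 = 1" "g $ 0 = 1"
  shows "(\<lambda>n. 1 /\<^sub>q f n) \<longlonglongrightarrow> 1 /\<^sub>q g"
proof (rule tendsto_fpsI)
  fix m
  have "\<forall>\<^sub>F n in sequentially. \<forall>l\<in>{..m}. f n $ l = g $ l"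
    using assms(1) by (intro eventually_ball_finite) (auto simp: tendsto_fps_iff)
  then show "\<forall>\<^sub>F n in sequentially. (1 /\<^sub>q f n) $ m = (1 /\<^sub>q g) $ m"
  proof eventually_elim
    case (elim n)
    have "1 /\<^sub>q f n - 1 /\<^sub>q g = (1 /\<^sub>q f n) * ((1 /\<^sub>q g) * g) - (1 /\<^sub>q g) * ((1 /\<^sub>q f n) * f n)"
      using assms by (simp add: fps_quot_mult)
    also have "\<dots> = (g - f n) * ((1 /\<^sub>q f n) * (1 /\<^sub>q g))"
      by (simp add: algebra_simps)
    finally have "(1 /\<^sub>q f n - 1 /\<^sub>q g) $ m = 0"
      using elim by (simp add: fps_mult_nth_eq_0)
    then show ?case by simp
  qed
qed

lemma prod_lessThan_add:
  "(\<Prod>i<(m + n :: nat). f i) = (\<Prod>i<m. f i) * (\<Prod>i<n. (f (m + i) :: 'a :: comm_monoid_mult))"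
  by (induction n) (simp_all add: mult_ac)

lemma tendsto_qpoch:
  assumes "s \<ge> 1" "t \<ge> 1"
  shows "(\<lambda>n. qpoch (qq ^ s) (qq ^ t) n) \<longlonglongrightarrow> qpoch_inf (qq ^ s) (qq ^ t)"
proof -
  let ?f = "\<lambda>i. 1 - qq ^ s * (qq ^ t) ^ i"
  have nz: "?f i \<noteq> 0" for i
  proof -
    have "?f i $ 0 = 1"
      using assms by simp
    then show ?thesis by force
  qed
  from qpoch_convergent(1)[OF assms] obtain M L' where "raw_has_prod ?f M L'"
    unfolding convergent_prod_def by blast
  then obtain L where L: "raw_has_prod ?f 0 L"
    using nz by (metis raw_has_prod_cases)
  then have "qpoch_inf (qq ^ s) (qq ^ t) = L"
    unfolding qpoch_inf_def by (intro has_prod_unique[symmetric]) (simp add: has_prod_def)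
  with L show ?thesis
    by (simp add: raw_has_prod_def qpoch_def LIMSEQ_lessThan_iff_atMost)
qed

lemma tendsto_inv_qpoch:
  assumes "t \<ge> 1"
  shows "(\<lambda>N. inv_qpoch (qq ^ t) (int N + j)) \<longlonglongrightarrow> 1 /\<^sub>q qpoch_inf (qq ^ t) (qq ^ t)"
proof -
  have "(\<lambda>n. 1 /\<^sub>q qpoch (qq ^ t) (qq ^ t) n) \<longlonglongrightarrow> 1 /\<^sub>q qpoch_inf (qq ^ t) (qq ^ t)"
    using assms by (intro tendsto_fps_quot_one tendsto_qpoch qpoch_nth_0 qpoch_convergent(2)) simp_all
  moreover have "filterlim (\<lambda>N. nat (int N + j)) sequentially sequentially"
    unfolding filterlim_at_top
  proof
    fix Z
    show "\<forall>\<^sub>F N in sequentially. Z \<le> nat (int N + j)"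
      using eventually_ge_at_top[of "nat (int Z + \<bar>j\<bar>)"] by eventually_elim linarith
  qed
  ultimately have "(\<lambda>N. 1 /\<^sub>q qpoch (qq ^ t) (qq ^ t) (nat (int N + j))) \<longlonglongrightarrow> 1 /\<^sub>q qpoch_inf (qq ^ t) (qq ^ t)"
    by (rule filterlim_compose)
  moreover have "\<forall>\<^sub>F N in sequentially. 1 /\<^sub>q qpoch (qq ^ t) (qq ^ t) (nat (int N + j)) = inv_qpoch (qq ^ t) (int N + j)"
    using eventually_ge_at_top[of "nat \<bar>j\<bar>"] by eventually_elim (auto simp: inv_qpoch_def)
  ultimately show ?thesis
    by (rule Lim_transform_eventually)
qed

lemma theta_coeff_small:
  assumes "1 \<le> s" "s < t"
  shows "finite {j \<in> UNIV. \<exists>l\<le>m. theta_coeff t s j $ l \<noteq> 0}"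
proof (rule finite_subset)
  show "{j \<in> UNIV. \<exists>l\<le>m. theta_coeff t s j $ l \<noteq> 0} \<subseteq> {- int m..int m}"
  proof
    fix j assume "j \<in> {j \<in> UNIV. \<exists>l\<le>m. theta_coeff t s j $ l \<noteq> 0}"
    then have le: "theta_exp t s j \<le> int m"
      by (auto simp: theta_coeff_def fps_X_power_nth split: if_splits)
    have "1 * (j * (j - 1)) + 1 * (j * (j + 1)) \<le> int (t - s) * (j * (j - 1)) + int s * (j * (j + 1))"
      using assms by (intro add_mono mult_right_mono consecutive_product_nonneg) auto
    also have "\<dots> = 2 * theta_exp t s j"
      by (rule two_times_theta_exp_split[symmetric]) (use assms in simp)
    finally have "j * j \<le> int m"
      using le by (simp add: algebra_simps)
    moreover have "\<bar>j\<bar> * 1 \<le> \<bar>j\<bar> * \<bar>j\<bar>"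
      by (cases "j = 0") (simp, intro mult_left_mono, auto)
    ultimately have "\<bar>j\<bar> \<le> int m"
      by (simp only: abs_mult_self_eq)
    then show "j \<in> {- int m..int m}"
      by auto
  qed
qed simp

text \<open>
  The \<open>q\<close>-binomial theorem in base \<open>p = q^t\<close> with \<open>2N\<close> factors at \<open>x = q^s\<close>, \<open>y = p^N\<close>, indexed by
  \<open>m = N + j\<close>.  Pulling the lower power of \<open>q\<close> out of each factor \<open>p^N - q^s p^i\<close> leaves
  \<open>1 - q^(t-s) p^(N-1-i)\<close> for \<open>i < N\<close> and \<open>1 - q^s p^(i-N)\<close> for \<open>i \<ge> N\<close>.
\<close>

lemma finite_jacobi_triple_product:
  assumes "s \<le> t" "t \<ge> 1"
  shows "(\<Sum>j\<in>{- int N..int N}. theta_coeff t s j * (inv_qpoch (qq ^ t) (int N + j) * inv_qpoch (qq ^ t) (int N - j)))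
         = inv_qpoch (qq ^ t) (int (2 * N)) * (qpoch (qq ^ s) (qq ^ t) N * qpoch (qq ^ (t - s)) (qq ^ t) N)"
proof -
  let ?p = "qq ^ t" and ?n = "N + N"
  \<comment> \<open>the total power of \<open>q\<close> pulled out of the \<open>2N\<close> factors\<close>
  let ?C = "s * N + t * (N choose 2) + t * N ^ 2"
  let ?g = "\<lambda>m. (-1) ^ m * ?p ^ (m choose 2) * (qq ^ s) ^ m * (?p ^ N) ^ (?n - m)
      * inv_qpoch ?p (int m) * inv_qpoch ?p (int ?n - int m)"
  have term_eq: "?g m = (-1) ^ N * qq ^ ?C * (theta_coeff t s (int m - int N)
      * (inv_qpoch ?p (int N + (int m - int N)) * inv_qpoch ?p (int N - (int m - int N))))"
    if m: "m \<le> ?n" for m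
  proof -
    let ?j = "int m - int N"
    have diff: "int (?n - m) = int ?n - int m" using m by simp
    have "2 * (int t * int (m choose 2) + int s * int m + int t * int N * int (?n - m))
        = 2 * int s * int N + int t * (2 * int (N choose 2)) + 2 * int t * int N ^ 2 + 2 * theta_exp t s ?j"
      unfolding diff two_times_theta_exp distrib_left mult.left_commute[of 2 "int t"] two_times_choose_two
      by (simp add: algebra_simps power2_eq_square)
    then have "int (t * (m choose 2) + s * m + t * N * (?n - m)) = int ?C + theta_exp t s ?j"
      by simp
    then have "t * (m choose 2) + s * m + t * N * (?n - m) = ?C + nat (theta_exp t s ?j)"
      using theta_exp_nonneg[OF assms(1), of ?j] by linarith
    then have "?p ^ (m choose 2) * (qq ^ s) ^ m * (?p ^ N) ^ (?n - m) = qq ^ ?C * qq ^ nat (theta_exp t s ?j)"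
      by (simp only: power_mult[symmetric] power_add[symmetric])
    moreover have "(-1) ^ m = (-1) ^ N * (if even ?j then 1 else - 1 :: int poly fps)"
      by (cases "even N"; cases "even m") auto
    moreover have "inv_qpoch ?p (int m) * inv_qpoch ?p (int ?n - int m) = inv_qpoch ?p (int N + ?j) * inv_qpoch ?p (int N - ?j)"
      by (simp add: algebra_simps)
    moreover have "?g m = (-1) ^ m * (?p ^ (m choose 2) * (qq ^ s) ^ m * (?p ^ N) ^ (?n - m))
        * (inv_qpoch ?p (int m) * inv_qpoch ?p (int ?n - int m))"
      by (simp only: mult.assoc)
    ultimately have "?g m = (-1) ^ N * (if even ?j then 1 else - 1) * (qq ^ ?C * qq ^ nat (theta_exp t s ?j))
        * (inv_qpoch ?p (int N + ?j) * inv_qpoch ?p (int N - ?j))"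
      by (simp only:)
    then show ?thesis
      by (simp only: theta_coeff_def mult_ac)
  qed
  have "(\<Prod>i<N. ?p ^ N - qq ^ s * ?p ^ i) = (\<Prod>i<N. - (qq ^ s * ?p ^ i) * (1 - qq ^ (t - s) * ?p ^ (N - Suc i)))"
  proof (rule prod.cong)
    fix i assume "i \<in> {..<N}"
    then obtain d where N: "N = Suc i + d" using less_iff_Suc_add by auto
    obtain u where u: "t = s + u" using assms le_Suc_ex by blast
    have "s + t * i + (t - s + t * d) = t * N"
      unfolding N u by (simp add: algebra_simps)
    then have "qq ^ s * ?p ^ i * (qq ^ (t - s) * ?p ^ (N - Suc i)) = ?p ^ N"
      using N by (simp flip: power_mult power_add)
    then show "?p ^ N - qq ^ s * ?p ^ i = - (qq ^ s * ?p ^ i) * (1 - qq ^ (t - s) * ?p ^ (N - Suc i))"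
      by (simp add: algebra_simps)
  qed simp
  also have "\<dots> = (\<Prod>i<N. - (qq ^ s * ?p ^ i)) * qpoch (qq ^ (t - s)) ?p N"
    unfolding qpoch_def prod.distrib prod.nat_diff_reindex[of "\<lambda>i. 1 - qq ^ (t - s) * ?p ^ i"] ..
  also have "(\<Prod>i<N. - (qq ^ s * ?p ^ i)) = (-1) ^ N * qq ^ (s * N + t * (N choose 2))"
  proof (induction N)
    case (Suc N)
    have "s * Suc N + t * (Suc N choose 2) = (s + t * N) + (s * N + t * (N choose 2))"
      by (simp add: numeral_2_eq_2 algebra_simps)
    then have "qq ^ (s * Suc N + t * (Suc N choose 2)) = (qq ^ s * ?p ^ N) * qq ^ (s * N + t * (N choose 2))"
      by (simp only: power_add power_mult)
    with Suc.IH show ?case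
      by (simp only: prod.lessThan_Suc power_Suc) (simp add: mult_ac)
  qed (simp add: numeral_2_eq_2)
  finally have low: "(\<Prod>i<N. ?p ^ N - qq ^ s * ?p ^ i)
      = (-1) ^ N * qq ^ (s * N + t * (N choose 2)) * qpoch (qq ^ (t - s)) ?p N" .
  have "(\<Prod>i<N. ?p ^ N - qq ^ s * ?p ^ (N + i)) = (\<Prod>i<N. ?p ^ N * (1 - qq ^ s * ?p ^ i))"
    by (simp add: power_add algebra_simps)
  also have "\<dots> = qq ^ (t * N ^ 2) * qpoch (qq ^ s) ?p N"
    by (simp add: prod.distrib qpoch_def power2_eq_square flip: power_mult)
  finally have high: "(\<Prod>i<N. ?p ^ N - qq ^ s * ?p ^ (N + i)) = qq ^ (t * N ^ 2) * qpoch (qq ^ s) ?p N" .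
  let ?S = "\<Sum>j\<in>{- int N..int N}. theta_coeff t s j * (inv_qpoch ?p (int N + j) * inv_qpoch ?p (int N - j))"
  have "(-1) ^ N * qq ^ ?C * ?S = (-1) ^ N * qq ^ ?C * (\<Sum>m\<le>?n. theta_coeff t s (int m - int N)
      * (inv_qpoch ?p (int N + (int m - int N)) * inv_qpoch ?p (int N - (int m - int N))))"
    by (rule arg_cong[of _ _ "\<lambda>x. _ * x"],
        rule sum.reindex_bij_witness[of _ "\<lambda>m. int m - int N" "\<lambda>j. nat (j + int N)"]) auto
  also have "\<dots> = (\<Sum>m\<le>?n. ?g m)"
    unfolding sum_distrib_left by (intro sum.cong refl term_eq[symmetric]) simp
  also have "\<dots> = inv_qpoch ?p (int ?n) * (\<Prod>i<?n. ?p ^ N - qq ^ s * ?p ^ i)"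
    by (rule q_binomial) (use assms in simp)
  also have "\<dots> = (-1) ^ N * qq ^ ?C * (inv_qpoch ?p (int (2 * N)) * (qpoch (qq ^ s) ?p N * qpoch (qq ^ (t - s)) ?p N))"
    unfolding prod_lessThan_add low high by (simp add: power_add mult_ac mult_2)
  finally show ?thesis
    by (simp only: mult_cancel_left) simp
qed

text \<open>
  Let \<open>N\<close> tend to infinity in the finite form and cancel one of the two factors \<open>1 / (p;p)\<^sub>\<infinity>\<close>.
\<close>

theorem jacobi_triple_product:
  assumes "1 \<le> s" "s < t"
  shows "(\<Sum>\<^sub>\<infinity>j. theta_coeff t s j) = qpoch_inf3 (qq ^ (t - s)) (qq ^ s) (qq ^ t) (qq ^ t)"
proof -
  let ?p = "qq ^ t"
  define R where "R = 1 /\<^sub>q qpoch_inf ?p ?p"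
  let ?A = "qpoch_inf (qq ^ s) ?p" and ?B = "qpoch_inf (qq ^ (t - s)) ?p"
  let ?k = "\<lambda>N j. inv_qpoch ?p (int N + j) * inv_qpoch ?p (int N - j)"
  have t: "t \<ge> 1" using assms by simp
  have R: "(\<lambda>N. inv_qpoch ?p (int N + j)) \<longlonglongrightarrow> R" for j
    unfolding R_def by (rule tendsto_inv_qpoch[OF t])
  have inv: "R * qpoch_inf ?p ?p = 1"
    unfolding R_def using t by (intro fps_quot_mult qpoch_convergent(2))
  have kernel: "(\<lambda>N. ?k N j) \<longlonglongrightarrow> R * R" for j
    using tendsto_mult[OF R[of j] R[of "- j"]] by simp
  have finite: "(\<Sum>\<^sub>\<infinity>j. theta_coeff t s j * ?k N j)
      = inv_qpoch ?p (int (2 * N)) * (qpoch (qq ^ s) ?p N * qpoch (qq ^ (t - s)) ?p N)" for N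
  proof -
    have "(\<Sum>\<^sub>\<infinity>j. theta_coeff t s j * ?k N j) = (\<Sum>\<^sub>\<infinity>j\<in>{- int N..int N}. theta_coeff t s j * ?k N j)"
      by (rule infsum_cong_neutral) auto
    then show ?thesis
      using finite_jacobi_triple_product[of s t N] assms by simp
  qed
  have "(\<lambda>N. \<Sum>\<^sub>\<infinity>j. theta_coeff t s j * ?k N j) \<longlonglongrightarrow> (\<Sum>\<^sub>\<infinity>j. theta_coeff t s j) * (R * R)"
    by (rule tannery_fps) (use theta_coeff_small[OF assms] kernel in auto)
  then have "(\<lambda>N. inv_qpoch ?p (int (2 * N)) * (qpoch (qq ^ s) ?p N * qpoch (qq ^ (t - s)) ?p N))
      \<longlonglongrightarrow> (\<Sum>\<^sub>\<infinity>j. theta_coeff t s j) * (R * R)"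
    by (simp only: finite)
  moreover have "(\<lambda>N. inv_qpoch ?p (int (2 * N)) * (qpoch (qq ^ s) ?p N * qpoch (qq ^ (t - s)) ?p N))
      \<longlonglongrightarrow> R * (?A * ?B)"
  proof (intro tendsto_mult tendsto_qpoch)
    show "(\<lambda>N. inv_qpoch ?p (int (2 * N))) \<longlonglongrightarrow> R"
      using LIMSEQ_subseq_LIMSEQ[OF R[of 0], of "\<lambda>N. 2 * N"] by (simp add: strict_mono_def o_def)
  qed (use assms in auto)
  ultimately have "(\<Sum>\<^sub>\<infinity>j. theta_coeff t s j) * (R * R) = R * (?A * ?B)"
    by (rule LIMSEQ_unique)
  then have "(\<Sum>\<^sub>\<infinity>j. theta_coeff t s j) * (R * R) * (qpoch_inf ?p ?p * qpoch_inf ?p ?p)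
      = R * (?A * ?B) * (qpoch_inf ?p ?p * qpoch_inf ?p ?p)"
    by (rule arg_cong)
  then have "(\<Sum>\<^sub>\<infinity>j. theta_coeff t s j) * (R * qpoch_inf ?p ?p) * (R * qpoch_inf ?p ?p)
      = (R * qpoch_inf ?p ?p) * (?A * ?B) * qpoch_inf ?p ?p"
    by (simp only: mult_ac)
  then show ?thesis
    unfolding inv qpoch_inf3_def by (simp add: mult_ac)
qed

section \<open>The multisum as a Bailey chain\<close>

text \<open>
  The nested sum over \<open>l\<close> variables bounded by \<open>N\<close>, the innermost being \<open>n\<^sub>k\<close>.  The linear term
  belongs to the \<open>a\<close> innermost variables, which are the first to be introduced; hence the
  condition \<open>l < a\<close>.
\<close>

primrec gordon_sum :: "nat \<Rightarrow> nat \<Rightarrow> nat \<Rightarrow> int poly fps" where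
  "gordon_sum a 0 N = inv_qpoch qq (int N)"
| "gordon_sum a (Suc l) N =
     (\<Sum>s\<le>N. qq ^ (s ^ 2 + of_bool (l < a) * s) * inv_qpoch qq (int N - int s) * gordon_sum a l s)"

text \<open>
  The value at \<open>l = 0\<close> is itself one Bailey step applied to the unit pair, as only \<open>r = 0\<close>
  survives.  That is why the base of the theta series is \<open>2l + 3\<close> and not \<open>2l + 1\<close>.
\<close>

lemma gordon_eq_bailey_sum_1: "l \<le> a \<Longrightarrow> gordon_sum a l N = bailey_sum 1 (theta_coeff (2 * l + 3) (2 * l + 2)) N"
proof (induction l arbitrary: N)
  case 0
  have "bailey_sum 1 (theta_coeff 3 2) N
      = (\<Sum>r\<le>N. qq ^ (r ^ 2 + 1 * r) * inv_qpoch qq (int N - int r) * bailey_sum 1 (theta_coeff 1 0) r)"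
    using bailey_step_theta[of 1 0 1 N] by (simp add: numeral_3_eq_3 numeral_2_eq_2)
  also have "\<dots> = (\<Sum>r\<in>{0}. qq ^ (r ^ 2 + 1 * r) * inv_qpoch qq (int N - int r) * bailey_sum 1 (theta_coeff 1 0) r)"
    by (rule sum.mono_neutral_right) (auto simp: unit_bailey_pair simp del: One_nat_def)
  also have "\<dots> = inv_qpoch qq (int N)"
    using unit_bailey_pair[of 0] by simp
  finally show ?case
    by (simp only: gordon_sum.simps mult_0_right add_0)
next
  case (Suc l)
  then show ?case
    using bailey_step_theta[of 1 "2 * l + 2" "2 * l + 3" N] by (simp add: algebra_simps)
qed

lemma gordon_eq_bailey_sum_0:
  "a \<le> l \<Longrightarrow> gordon_sum a l N = bailey_sum 0 (theta_coeff (2 * l + 3) (l + a + 2)) N"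
proof (induction l arbitrary: N rule: dec_induct)
  case base
  have "bailey_sum 1 (theta_coeff (2 * a + 3) (2 * a + 2)) N = bailey_sum 0 (theta_coeff (2 * a + 3) (2 * a + 2)) N"
    using bailey_lattice_step[of "2 * a + 3" N] by simp
  then show ?case
    by (simp only: gordon_eq_bailey_sum_1 order_refl mult_2)
next
  case (step l)
  then show ?case
    using bailey_step_theta[of 0 "l + a + 2" "2 * l + 3" N] by (simp add: algebra_simps)
qed

text \<open>
  The outermost sum with \<open>l + 1\<close> variables tends to \<open>1 / (q)\<^sub>\<infinity>\<close> times the series on the left, whereas
  its bilateral form tends to \<open>1 / (q)\<^sub>\<infinity>^2\<close> times a theta series.
\<close>

theorem gordon_limit:
  assumes "a \<le> Suc l"
  shows "(\<Sum>\<^sub>\<infinity>s. qq ^ (s ^ 2 + of_bool (l < a) * s) * gordon_sum a l s)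
         = qpoch_inf3 (qq ^ (Suc l + 1 - a)) (qq ^ (Suc l + 2 + a)) (qq ^ (2 * Suc l + 3)) (qq ^ (2 * Suc l + 3))
             /\<^sub>q qpoch_inf qq qq"
proof -
  let ?c = "theta_coeff (2 * Suc l + 3) (Suc l + a + 2)"
  let ?w = "\<lambda>s. qq ^ (s ^ 2 + of_bool (l < a) * s) * gordon_sum a l s"
  define R where "R = 1 /\<^sub>q qpoch_inf qq qq"
  have R: "(\<lambda>N. inv_qpoch qq (int N + j)) \<longlonglongrightarrow> R" for j
    using tendsto_inv_qpoch[of 1 j] by (simp add: R_def)
  have inv: "R * qpoch_inf qq qq = 1"
    unfolding R_def using qpoch_convergent(2)[of 1 1] by (intro fps_quot_mult) simp
  have "(\<lambda>N. \<Sum>\<^sub>\<infinity>j. ?c j * bailey_kernel 0 N j) \<longlonglongrightarrow> (\<Sum>\<^sub>\<infinity>j. ?c j) * (R * R)"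
  proof (rule tannery_fps)
    show "(\<lambda>N. bailey_kernel 0 N j) \<longlonglongrightarrow> R * R" for j
      using tendsto_mult[OF R[of "- j"] R[of j]] by (simp add: bailey_kernel_def)
    show "finite {j \<in> UNIV. \<exists>l\<le>m. ?c j $ l \<noteq> 0}" for m
      by (rule theta_coeff_small) (use assms in auto)
  qed
  moreover have "(\<Sum>\<^sub>\<infinity>j. ?c j * bailey_kernel 0 N j) = gordon_sum a (Suc l) N" for N
  proof -
    have "(\<Sum>\<^sub>\<infinity>j. ?c j * bailey_kernel 0 N j) = (\<Sum>\<^sub>\<infinity>j\<in>{- int N - 1..int N}. ?c j * bailey_kernel 0 N j)"
      by (rule infsum_cong_neutral) (auto simp: bailey_kernel_def)
    then show ?thesis
      using assms by (simp only: gordon_eq_bailey_sum_0 bailey_sum_def infsum_finite finite_atLeastAtMost_int)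
  qed
  ultimately have lim1: "(\<lambda>N. gordon_sum a (Suc l) N) \<longlonglongrightarrow> (\<Sum>\<^sub>\<infinity>j. ?c j) * (R * R)"
    by (simp only:)
  have "(\<lambda>N. \<Sum>\<^sub>\<infinity>s. ?w s * inv_qpoch qq (int N - int s)) \<longlonglongrightarrow> (\<Sum>\<^sub>\<infinity>s. ?w s) * R"
  proof (rule tannery_fps)
    show "(\<lambda>N. inv_qpoch qq (int N - int s)) \<longlonglongrightarrow> R" for s
      using R[of "- int s"] by simp
    show "finite {s \<in> UNIV. \<exists>l'\<le>m. ?w s $ l' \<noteq> 0}" for m
    proof (rule finite_subset)
      have "s \<le> l'" if "?w s $ l' \<noteq> 0" for s l'
      proof -
        have "s ^ 2 + of_bool (l < a) * s \<le> l'"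
          using that by (simp only: fps_X_power_mult_nth not_less split: if_splits)
        moreover have "s \<le> s ^ 2"
          by (simp add: power2_eq_square)
        ultimately show ?thesis by linarith
      qed
      then show "{s \<in> UNIV. \<exists>l'\<le>m. ?w s $ l' \<noteq> 0} \<subseteq> {..m}"
        using order_trans by blast
    qed simp
  qed
  moreover have "(\<Sum>\<^sub>\<infinity>s. ?w s * inv_qpoch qq (int N - int s)) = gordon_sum a (Suc l) N" for N
  proof -
    have "(\<Sum>\<^sub>\<infinity>s. ?w s * inv_qpoch qq (int N - int s)) = (\<Sum>\<^sub>\<infinity>s\<in>{..N}. ?w s * inv_qpoch qq (int N - int s))"
      by (rule infsum_cong_neutral) auto
    then show ?thesis by (simp add: mult_ac)
  qed
  ultimately have "(\<lambda>N. gordon_sum a (Suc l) N) \<longlonglongrightarrow> (\<Sum>\<^sub>\<infinity>s. ?w s) * R"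
    by (simp only:)
  with lim1 have "(\<Sum>\<^sub>\<infinity>s. ?w s) * R = (\<Sum>\<^sub>\<infinity>j. ?c j) * (R * R)"
    using LIMSEQ_unique by blast
  then have "(\<Sum>\<^sub>\<infinity>s. ?w s) * R * qpoch_inf qq qq = (\<Sum>\<^sub>\<infinity>j. ?c j) * (R * R) * qpoch_inf qq qq"
    by (rule arg_cong)
  then have "(\<Sum>\<^sub>\<infinity>s. ?w s) * (R * qpoch_inf qq qq) = (\<Sum>\<^sub>\<infinity>j. ?c j) * R * (R * qpoch_inf qq qq)"
    by (simp only: mult_ac)
  then have "(\<Sum>\<^sub>\<infinity>s. ?w s) = (\<Sum>\<^sub>\<infinity>j. ?c j) * R"
    by (simp only: inv mult_1_right)
  also have "(\<Sum>\<^sub>\<infinity>j. ?c j) = qpoch_inf3 (qq ^ (2 * Suc l + 3 - (Suc l + a + 2))) (qq ^ (Suc l + a + 2))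
      (qq ^ (2 * Suc l + 3)) (qq ^ (2 * Suc l + 3))"
    by (rule jacobi_triple_product) (use assms in auto)
  also have "2 * Suc l + 3 - (Suc l + a + 2) = Suc l + 1 - a"
    by simp
  also have "Suc l + a + 2 = Suc l + 2 + a"
    by simp
  finally show ?thesis
    by (simp add: R_def fps_quot_def)
qed

section \<open>Splitting the multisum by the number of positive entries\<close>

text \<open>
  The summand attached to \<open>n\<^sub>1 \<ge> \<dots> \<ge> n\<^sub>r\<close> without its last denominator, so that it can be closed off by
  that denominator or continued by a further entry.
\<close>

definition tuple_weight :: "nat \<Rightarrow> nat \<Rightarrow> nat \<Rightarrow> (nat \<Rightarrow> nat) \<Rightarrow> int poly fps" where
  "tuple_weight k a r n =
     qq ^ ((\<Sum>i=1..r. n i ^ 2) + (\<Sum>i=k+1-a..r. n i)) * (\<Prod>i=1..<r. inv_qpoch qq (int (n i) - int (n (i + 1))))"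

lemma inv_qpoch_eq_quot:
  assumes "n \<ge> 1"
  shows "1 /\<^sub>q qpoch (qq ^ 2) qq (n - 1) = inv_qpoch qq (int n) * (1 - qq)"
proof -
  obtain m where m: "n = Suc m" using assms by (cases n) auto
  have "qpoch qq qq n = (1 - qq) * qpoch (qq ^ 2) qq (n - 1)"
    unfolding qpoch_def m prod.lessThan_Suc_shift by (simp add: power2_eq_square mult_ac)
  then have "inv_qpoch qq (int n) * ((1 - qq) * qpoch (qq ^ 2) qq (n - 1)) = 1"
    using inv_qpoch_mult_qpoch[of qq n] by simp
  then show ?thesis
    by (intro fps_quot_eqI qpoch_nth_0) (simp_all add: mult.assoc power2_eq_square)
qed

lemma multisum_term_eq_weight:
  assumes "n \<in> decr_tuples r" "r \<ge> 1"
  shows "multisum_term k a r n = tuple_weight k a r n * inv_qpoch qq (int (n r)) * (1 - qq)"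
proof -
  let ?Q = "\<Prod>i=1..<r. qpoch qq qq (n i - n (i + 1))" and ?Q' = "qpoch (qq ^ 2) qq (n r - 1)"
  let ?P = "\<Prod>i=1..<r. inv_qpoch qq (int (n i) - int (n (i + 1)))"
  have inv: "inv_qpoch qq (int m) * qpoch qq qq m = 1" for m
    by (rule inv_qpoch_mult_qpoch) simp
  have "?P * ?Q = (\<Prod>i=1..<r. inv_qpoch qq (int (n i) - int (n (i + 1))) * qpoch qq qq (n i - n (i + 1)))"
    by (simp only: prod.distrib)
  also have "\<dots> = 1"
  proof (rule prod.neutral, rule ballI)
    fix i assume "i \<in> {1..<r}"
    then have "int (n i) - int (n (i + 1)) = int (n i - n (i + 1))"
      using assms by (auto simp: decr_tuples_def of_nat_diff)
    then show "inv_qpoch qq (int (n i) - int (n (i + 1))) * qpoch qq qq (n i - n (i + 1)) = 1"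
      by (simp only: inv)
  qed
  finally have 1: "?P * ?Q = 1" .
  have "n r \<ge> 1"
    using assms by (auto simp: decr_tuples_def PiE_iff)
  then have "inv_qpoch qq (int (n r)) * (1 - qq) * ?Q' = (1 /\<^sub>q ?Q') * ?Q'"
    by (simp only: inv_qpoch_eq_quot)
  also have "\<dots> = 1"
    by (rule fps_quot_mult, rule qpoch_nth_0) (simp add: power2_eq_square)
  finally have 2: "inv_qpoch qq (int (n r)) * (1 - qq) * ?Q' = 1" .
  have "tuple_weight k a r n * inv_qpoch qq (int (n r)) * (1 - qq) * (?Q * ?Q')
      = qq ^ ((\<Sum>i=1..r. n i ^ 2) + (\<Sum>i=k+1-a..r. n i)) * (?P * ?Q) * (inv_qpoch qq (int (n r)) * (1 - qq) * ?Q')"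
    by (simp only: tuple_weight_def mult_ac)
  then have "qq ^ ((\<Sum>i=1..r. n i ^ 2) + (\<Sum>i=k+1-a..r. n i))
      = tuple_weight k a r n * inv_qpoch qq (int (n r)) * (1 - qq) * (?Q * ?Q')"
    by (simp only: 1 2 mult_1_right)
  then show ?thesis
    unfolding multisum_term_def by (intro fps_quot_eqI multisum_denominator_nth_0)
qed

lemma tuple_weight_summable: "(\<lambda>n. tuple_weight k a r n * h n) summable_on decr_tuples r"
proof (rule summable_on_fpsI)
  fix m
  have "n \<in> {1..r} \<rightarrow>\<^sub>E {..m}"
    if n: "n \<in> decr_tuples r" and nz: "(tuple_weight k a r n * h n) $ m \<noteq> 0" for n
  proof -
    have e: "(\<Sum>i=1..r. n i ^ 2) + (\<Sum>i=k+1-a..r. n i) \<le> m"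
      using nz unfolding tuple_weight_def mult.assoc
      by (simp only: fps_X_power_mult_nth not_less split: if_splits)
    have "n i \<le> m" if "i \<in> {1..r}" for i
    proof -
      have "n i \<le> n i ^ 2"
        by (simp add: power2_eq_square)
      also have "\<dots> \<le> (\<Sum>i=1..r. n i ^ 2)"
        using that by (intro member_le_sum) auto
      finally show ?thesis using e by linarith
    qed
    then show ?thesis
      using n by (auto simp: decr_tuples_def PiE_iff)
  qed
  then have "{n \<in> decr_tuples r. (tuple_weight k a r n * h n) $ m \<noteq> 0} \<subseteq> {1..r} \<rightarrow>\<^sub>E {..m}"
    by blast
  then show "finite {n \<in> decr_tuples r. (tuple_weight k a r n * h n) $ m \<noteq> 0}"
    by (rule finite_subset) (intro finite_PiE, auto)
qed

text \<open>
  The new entry has index \<open>r + 1\<close>, so it contributes to the linear part of the exponent exactly when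
  \<open>k + 1 - a \<le> r + 1\<close>.
\<close>

lemma tuple_weight_extend:
  assumes "1 \<le> r" "a \<le> k"
  shows "tuple_weight k a (Suc r) (n(Suc r := s))
         = tuple_weight k a r n * (qq ^ (s ^ 2 + of_bool (k \<le> a + r) * s) * inv_qpoch qq (int (n r) - int s))"
proof -
  let ?n = "n(Suc r := s)"
  have sq: "(\<Sum>i=1..Suc r. ?n i ^ 2) = (\<Sum>i=1..r. n i ^ 2) + s ^ 2"
    by (simp add: sum.cong[of "{1..r}" "{1..r}" "\<lambda>i. ?n i ^ 2" "\<lambda>i. n i ^ 2"])
  have "(\<Sum>i=k+1-a..r. ?n i) = (\<Sum>i=k+1-a..r. n i)"
    by (rule sum.cong) auto
  then have lin: "(\<Sum>i=k+1-a..Suc r. ?n i) = (\<Sum>i=k+1-a..r. n i) + of_bool (k \<le> a + r) * s"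
    using assms by (cases "k + 1 - a \<le> Suc r") auto
  have "(\<Prod>i=1..<Suc r. inv_qpoch qq (int (?n i) - int (?n (i + 1))))
      = (\<Prod>i=1..<r. inv_qpoch qq (int (?n i) - int (?n (i + 1)))) * inv_qpoch qq (int (n r) - int s)"
    using assms by (simp add: prod.atLeastLessThan_Suc)
  also have "(\<Prod>i=1..<r. inv_qpoch qq (int (?n i) - int (?n (i + 1))))
      = (\<Prod>i=1..<r. inv_qpoch qq (int (n i) - int (n (i + 1))))"
    by (rule prod.cong) auto
  finally show ?thesis
    unfolding tuple_weight_def sq lin by (simp only: power_add mult_ac)
qed

lemma bij_betw_decr_tuples_Suc:
  assumes "1 \<le> r"
  shows "bij_betw (\<lambda>(n, s). n(Suc r := s)) (SIGMA n:decr_tuples r. {1..n r}) (decr_tuples (Suc r))"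
proof (rule bij_betw_byWitness[where f' = "\<lambda>n. (n(Suc r := undefined), n (Suc r))"])
  show "\<forall>p\<in>SIGMA n:decr_tuples r. {1..n r}.
      (\<lambda>n. (n(Suc r := undefined), n (Suc r))) (case p of (n, s) \<Rightarrow> n(Suc r := s)) = p"
    by (auto simp: decr_tuples_def PiE_iff extensional_def fun_eq_iff)
  show "(\<lambda>(n, s). n(Suc r := s)) ` (SIGMA n:decr_tuples r. {1..n r}) \<subseteq> decr_tuples (Suc r)"
    using assms by (auto simp: decr_tuples_def PiE_iff extensional_def less_Suc_eq le_Suc_eq)
  show "(\<lambda>n. (n(Suc r := undefined), n (Suc r))) ` decr_tuples (Suc r) \<subseteq> (SIGMA n:decr_tuples r. {1..n r})"
    using assms by (auto simp: decr_tuples_def PiE_iff extensional_def)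
qed auto

lemma bij_betw_decr_tuples_1: "bij_betw (\<lambda>n. n 1) (decr_tuples 1) {1..}"
  by (rule bij_betw_byWitness[where f' = "\<lambda>s. \<lambda>i\<in>{1..1}. s"])
     (auto simp: decr_tuples_def PiE_iff extensional_def fun_eq_iff)

lemma infsum_decr_tuples_1: "(\<Sum>\<^sub>\<infinity>n\<in>decr_tuples 1. F (n 1)) = (\<Sum>\<^sub>\<infinity>s\<in>{1..}. F s)"
  by (rule infsum_reindex_bij_betw[OF bij_betw_decr_tuples_1])

lemma gordon_sum_0_right [simp]: "gordon_sum a l 0 = 1"
  by (induction l) auto

text \<open>
  In \<open>tail_sum\<close> the entries after the \<open>r\<close>-th one are free, possibly zero; in \<open>stratum_sum\<close> they
  are all zero.
\<close>

definition tail_sum :: "nat \<Rightarrow> nat \<Rightarrow> nat \<Rightarrow> int poly fps" where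
  "tail_sum k a r = (\<Sum>\<^sub>\<infinity>n\<in>decr_tuples r. tuple_weight k a r n * gordon_sum a (k - r) (n r))"

definition stratum_sum :: "nat \<Rightarrow> nat \<Rightarrow> nat \<Rightarrow> int poly fps" where
  "stratum_sum k a r = (\<Sum>\<^sub>\<infinity>n\<in>decr_tuples r. tuple_weight k a r n * inv_qpoch qq (int (n r)))"

text \<open>
  Either the entry after the \<open>r\<close>-th one vanishes, and with it all later ones, or it is positive and
  the tuple of positive entries has length at least \<open>r + 1\<close>.
\<close>

lemma tail_sum_step:
  assumes "1 \<le> r" "r < k" "a \<le> k"
  shows "tail_sum k a r = stratum_sum k a r + tail_sum k a (Suc r)"
proof -
  define l where "l = k - Suc r"
  have l: "k - r = Suc l" and la: "l < a \<longleftrightarrow> k \<le> a + r"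
    using assms by (auto simp: l_def)
  let ?g = "\<lambda>n s. qq ^ (s ^ 2 + of_bool (k \<le> a + r) * s) * inv_qpoch qq (int (n r) - int s) * gordon_sum a l s"
  let ?G = "\<lambda>n. \<Sum>s\<in>{1..n r}. ?g n s"
  let ?w = "tuple_weight k a r"
  have split: "gordon_sum a (k - r) (n r) = inv_qpoch qq (int (n r)) + ?G n" for n
  proof -
    have "{..n r} = insert 0 {1..n r}" by auto
    then show ?thesis by (simp add: l la)
  qed
  let ?F = "\<lambda>n. tuple_weight k a (Suc r) n * gordon_sum a l (n (Suc r))"
  let ?B = "SIGMA n:decr_tuples r. {1..n r}"
  note bij = bij_betw_decr_tuples_Suc[OF assms(1)]
  have extend: "(\<lambda>p. ?F (case p of (n, s) \<Rightarrow> n(Suc r := s))) = (\<lambda>(n, s). ?w n * ?g n s)"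
  proof
    fix p :: "(nat \<Rightarrow> nat) \<times> nat"
    show "?F (case p of (n, s) \<Rightarrow> n(Suc r := s)) = (case p of (n, s) \<Rightarrow> ?w n * ?g n s)"
      by (cases p) (simp only: prod.case tuple_weight_extend[OF assms(1,3)] fun_upd_same mult.assoc)
  qed
  have "?F summable_on decr_tuples (Suc r)"
    by (rule tuple_weight_summable)
  then have summ: "(\<lambda>(n, s). ?w n * ?g n s) summable_on ?B"
    using summable_on_reindex_bij_betw[OF bij, of ?F] by (simp only: extend)
  have "tail_sum k a (Suc r) = infsum ?F (decr_tuples (Suc r))"
    by (simp only: tail_sum_def l_def)
  also have "\<dots> = (\<Sum>\<^sub>\<infinity>(n, s)\<in>?B. ?w n * ?g n s)"
    using infsum_reindex_bij_betw[OF bij, of ?F] by (simp only: extend)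
  also have "\<dots> = (\<Sum>\<^sub>\<infinity>n\<in>decr_tuples r. \<Sum>\<^sub>\<infinity>s\<in>{1..n r}. ?w n * ?g n s)"
    by (rule infsum_Sigma'[symmetric]) (use summ uniformly_continuous_fps_add in auto)
  also have "\<dots> = (\<Sum>\<^sub>\<infinity>n\<in>decr_tuples r. ?w n * ?G n)"
    by (simp add: sum_distrib_left)
  finally have "stratum_sum k a r + tail_sum k a (Suc r)
      = (\<Sum>\<^sub>\<infinity>n\<in>decr_tuples r. ?w n * inv_qpoch qq (int (n r)) + ?w n * ?G n)"
    unfolding stratum_sum_def
    by (simp only:) (rule infsum_add[symmetric]; rule tuple_weight_summable)
  then show ?thesis
    by (simp only: tail_sum_def split distrib_left)
qed

lemma tail_sum_eq_strata:
  assumes "1 \<le> k" "a \<le> k"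
  shows "tail_sum k a 1 = (\<Sum>r=1..k. stratum_sum k a r)"
proof -
  have "tail_sum k a 1 = (\<Sum>i=1..<r. stratum_sum k a i) + tail_sum k a r" if "1 \<le> r" "r \<le> k" for r
    using that
  proof (induction r rule: dec_induct)
    case (step r)
    then show ?case
      using tail_sum_step[of r k a] assms by (simp add: add_ac)
  qed simp
  from this[of k] have "tail_sum k a 1 = (\<Sum>i=1..<k. stratum_sum k a i) + stratum_sum k a k"
    using assms by (simp add: tail_sum_def stratum_sum_def)
  also have "\<dots> = (\<Sum>r=1..k. stratum_sum k a r)"
    using assms by (simp add: sum.last_plus add.commute)
  finally show ?thesis .
qed

lemma tuple_weight_1:
  assumes "1 \<le> k" "a \<le> k"
  shows "tuple_weight k a 1 n = qq ^ (n 1 ^ 2 + of_bool (k \<le> a) * n 1)"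
proof -
  have "(\<Sum>i=k+1-a..1. n i) = of_bool (k \<le> a) * n 1"
    using assms by (cases "a = k") auto
  then show ?thesis by (simp add: tuple_weight_def)
qed

section \<open>The Andrews--Gordon identity and its parametric form\<close>

text \<open>
  The outermost variable of \<open>gordon_limit\<close> starts at 0.  Its value 0 forces the zero tuple, and its
  positive values make up \<open>tail_sum k a 1\<close>, from which the strata are peeled off one by one.
\<close>

theorem andrews_gordon:
  assumes "1 \<le> k" "a \<le> k"
  shows "qpoch_inf3 (qq ^ (k + 1 - a)) (qq ^ (k + 2 + a)) (qq ^ (2 * k + 3)) (qq ^ (2 * k + 3)) /\<^sub>q qpoch_inf qq qq
         = 1 + (\<Sum>r=1..k. stratum_sum k a r)"
proof -
  obtain l where l: "k = Suc l" using assms by (cases k) auto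
  let ?w = "\<lambda>s. qq ^ (s ^ 2 + of_bool (k \<le> a) * s) * gordon_sum a l s"
  have la: "l < a \<longleftrightarrow> k \<le> a" by (auto simp: l)
  have summ: "?w summable_on {1..}"
    using tuple_weight_summable[of k a 1 "\<lambda>n. gordon_sum a l (n 1)"]
    by (simp only: tuple_weight_1[OF assms] summable_on_reindex_bij_betw[OF bij_betw_decr_tuples_1, of ?w])
  have "qpoch_inf3 (qq ^ (k + 1 - a)) (qq ^ (k + 2 + a)) (qq ^ (2 * k + 3)) (qq ^ (2 * k + 3)) /\<^sub>q qpoch_inf qq qq
      = (\<Sum>\<^sub>\<infinity>s. ?w s)"
    using gordon_limit[of a l] assms unfolding la l by (simp only:)
  also have "\<dots> = (\<Sum>\<^sub>\<infinity>s\<in>{0} \<union> {1..}. ?w s)"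
    by (rule arg_cong[of _ _ "infsum _"]) auto
  also have "\<dots> = (\<Sum>\<^sub>\<infinity>s\<in>{0}. ?w s) + (\<Sum>\<^sub>\<infinity>s\<in>{1..}. ?w s)"
    by (rule infsum_Un_disjoint) (use summ in auto)
  also have "(\<Sum>\<^sub>\<infinity>s\<in>{1..}. ?w s) = tail_sum k a 1"
    unfolding tail_sum_def tuple_weight_1[OF assms] infsum_decr_tuples_1[symmetric] by (simp add: l)
  finally show ?thesis
    using tail_sum_eq_strata[OF assms] by simp
qed

lemma qint_Suc: "qint (Suc n) = qint n + qq ^ n"
proof -
  have "qint n * (1 - qq) = 1 - qq ^ n"
    unfolding qint_def by (rule fps_quot_mult) simp
  then have "(qint n + qq ^ n) * (1 - qq) = 1 - qq ^ Suc n"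
    by (simp only: distrib_right) (simp add: algebra_simps)
  then show ?thesis
    unfolding qint_def[of "Suc n"] by (intro fps_quot_eqI) simp_all
qed

text \<open>
  Both sides are combinations of \<open>[m]\<^sub>q\<close> and powers of \<open>q\<close> once \<open>[M]\<^sub>q\<close> is expanded by
  \<open>[m + 1]\<^sub>q = [m]\<^sub>q + q^m\<close>: once when \<open>a < k\<close>, twice when \<open>a = k\<close>, which is where \<open>M \<ge> 2\<close> is needed.
\<close>

lemma A_term_absorbs:
  assumes "a \<le> k" "M > 0" "a = k \<Longrightarrow> M \<ge> 2"
  shows "1 - qq ^ M + qq ^ (1 + B_exp k a 1) * qint M
         = (1 - xx * qq ^ M) * (1 + A_term k a M)"
proof -
  have D: "(1 - xx * qq ^ M) $ 0 = 1"
    using assms by simp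
  have quot: "(1 - xx * qq ^ M) * (f /\<^sub>q (1 - xx * qq ^ M)) = f" for f
    using fps_quot_mult[OF D] by (simp add: mult.commute)
  show ?thesis
  proof (cases "a < k")
    case True
    obtain m where "M = Suc m" using assms by (cases M) auto
    moreover have "(1 - xx * qq ^ M) * (1 + A_term k a M)
        = 1 - xx * qq ^ M + qq * (qint (M - 1) + xx * qq ^ (M - 1))"
      unfolding A_term_def if_P[OF True] distrib_left[of "1 - xx * qq ^ M"] quot by simp
    ultimately show ?thesis
      using True by (simp add: B_exp_def qint_Suc algebra_simps)
  next
    case False
    then obtain m where "M = Suc (Suc m)" using assms by (metis Suc_le_D le_antisym not_le numeral_2_eq_2 Suc_le_mono)
    moreover have "(1 - xx * qq ^ M) * (1 + A_term k a M)
        = 1 - xx * qq ^ M + qq ^ 2 * (qint (M - 2) + xx * qq ^ (M - 2) + qq ^ (M - 1))"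
      unfolding A_term_def if_not_P[OF False] distrib_left[of "1 - xx * qq ^ M"] quot by simp
    ultimately show ?thesis
      using False by (simp add: B_exp_def qint_Suc algebra_simps power2_eq_square)
  qed
qed

theorem theorem4p2:
  fixes k a M :: nat
  assumes "k \<ge> 1" and "a \<le> k" and "M > 0"
    and "\<not> [int M = 0] (mod (2 * int k + 3))"
    and "\<not> [int M = int k + 1 - int a] (mod (2 * int k + 3))"
    and "\<not> [int M = - (int k + 1 - int a)] (mod (2 * int k + 3))"
  shows
    "((1 - qq ^ M) /\<^sub>q (1 - xx * qq ^ M)) *
       (qpoch_inf3 (qq ^ (k + 1 - a)) (qq ^ (k + 2 + a)) (qq ^ (2 * k + 3)) (qq ^ (2 * k + 3))
          /\<^sub>q qpoch_inf qq qq)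
     = 1 + A_term k a M
       + (\<Sum>\<^sub>\<infinity>n\<in>{2..}. (qq ^ (n ^ 2 + B_exp k a n) /\<^sub>q qpoch (qq ^ 2) qq (n - 1))
                         * (qint M /\<^sub>q (1 - xx * qq ^ M)))
       + (\<Sum>r=2..k. \<Sum>\<^sub>\<infinity>n\<in>decr_tuples r.
            multisum_term k a r n * (qint M /\<^sub>q (1 - xx * qq ^ M)))"
proof -
  let ?D = "1 - xx * qq ^ M"
  define c where "c = (1 - qq ^ M) /\<^sub>q ?D"
  have D: "?D $ 0 = 1"
    using assms(3) by simp
  have qint: "qint M * (1 - qq) = 1 - qq ^ M"
    unfolding qint_def by (rule fps_quot_mult) simp
  then have c: "(1 - qq) * (qint M /\<^sub>q ?D) = c"
    by (simp add: c_def fps_quot_def mult_ac flip: qint)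
  have strata: "(\<Sum>\<^sub>\<infinity>n\<in>decr_tuples r. multisum_term k a r n * (qint M /\<^sub>q ?D)) = c * stratum_sum k a r"
    if "r \<ge> 1" for r
  proof -
    have "(\<Sum>\<^sub>\<infinity>n\<in>decr_tuples r. multisum_term k a r n * (qint M /\<^sub>q ?D))
        = (\<Sum>\<^sub>\<infinity>n\<in>decr_tuples r. c * (tuple_weight k a r n * inv_qpoch qq (int (n r))))"
      by (rule infsum_cong) (simp only: multisum_term_eq_weight[OF _ that] mult_ac flip: c)
    also have "\<dots> = c * stratum_sum k a r"
      unfolding stratum_sum_def by (rule infsum_cmult_right) (rule tuple_weight_summable)
    finally show ?thesis .
  qed
  let ?f = "\<lambda>n. (qq ^ (n ^ 2 + B_exp k a n) /\<^sub>q qpoch (qq ^ 2) qq (n - 1)) * (qint M /\<^sub>q ?D)"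
  have "c * stratum_sum k a 1 = (\<Sum>\<^sub>\<infinity>n\<in>decr_tuples 1. ?f (n 1))"
    unfolding strata[OF order_refl, symmetric]
  proof (rule infsum_cong)
    fix n assume "n \<in> decr_tuples 1"
    have "(\<Sum>i=k+1-a..1. n i) = B_exp k a (n 1)"
      using assms(1,2) by (cases "a = k") (auto simp: B_exp_def)
    then show "multisum_term k a 1 n * (qint M /\<^sub>q ?D) = ?f (n 1)"
      by (simp add: multisum_term_def)
  qed
  also have "\<dots> = (\<Sum>\<^sub>\<infinity>n\<in>{1} \<union> {2..}. ?f n)"
    unfolding infsum_decr_tuples_1[of ?f] by (rule arg_cong[of _ _ "infsum _"]) auto
  also have "\<dots> = (\<Sum>\<^sub>\<infinity>n\<in>{1}. ?f n) + (\<Sum>\<^sub>\<infinity>n\<in>{2..}. ?f n)"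
    by (rule infsum_Un_disjoint) (use single_sum_summable[of k a "qint M /\<^sub>q ?D"] in simp_all)
  also have "(\<Sum>\<^sub>\<infinity>n\<in>{1}. ?f n) = qq ^ (1 + B_exp k a 1) * (qint M /\<^sub>q ?D)"
    by (simp add: qpoch_def fps_quot_eqI)
  finally have first: "c * stratum_sum k a 1
      = qq ^ (1 + B_exp k a 1) * (qint M /\<^sub>q ?D) + (\<Sum>\<^sub>\<infinity>n\<in>{2..}. ?f n)" .
  \<comment> \<open>for \<open>a = k\<close> the excluded residue \<open>k + 1 - a\<close> is 1\<close>
  have "M \<ge> 2" if "a = k"
  proof -
    have "M \<noteq> 1" using assms(5) that by auto
    then show ?thesis using assms(3) by simp
  qed
  then have numerator: "1 - qq ^ M + qq ^ (1 + B_exp k a 1) * qint M = (1 + A_term k a M) * ?D"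
    using A_term_absorbs[OF assms(2,3)] by (simp only: mult.commute)
  have "c + qq ^ (1 + B_exp k a 1) * (qint M /\<^sub>q ?D) = ((1 + A_term k a M) * ?D) /\<^sub>q ?D"
    unfolding numerator[symmetric] by (simp only: c_def fps_quot_def distrib_right mult.assoc)
  also have "\<dots> = 1 + A_term k a M"
    by (rule fps_quot_eqI[OF D refl])
  finally have absorb: "c + qq ^ (1 + B_exp k a 1) * (qint M /\<^sub>q ?D) = 1 + A_term k a M" .
  have "(\<Sum>r=1..k. c * stratum_sum k a r) = c * stratum_sum k a 1 + (\<Sum>r=2..k. c * stratum_sum k a r)"
    using assms(1) by (simp add: sum.atLeast_Suc_atMost numeral_2_eq_2)
  then have "c * (1 + (\<Sum>r=1..k. stratum_sum k a r))
      = (c + qq ^ (1 + B_exp k a 1) * (qint M /\<^sub>q ?D)) + (\<Sum>\<^sub>\<infinity>n\<in>{2..}. ?f n)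
        + (\<Sum>r=2..k. c * stratum_sum k a r)"
    by (simp only: distrib_left sum_distrib_left first mult_1_right add.assoc)
  also have "(\<Sum>r=2..k. c * stratum_sum k a r)
      = (\<Sum>r=2..k. \<Sum>\<^sub>\<infinity>n\<in>decr_tuples r. multisum_term k a r n * (qint M /\<^sub>q ?D))"
    by (rule sum.cong) (simp_all add: strata)
  finally show ?thesis
    by (simp only: absorb andrews_gordon[OF assms(1,2)] flip: c_def)
qed

end
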